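(* Let $(\Omega,\mathcal F,(\mathcal F_n)_{n\ge0},\mathbb P)$ be a filtered probability space with associated collection $\mathcal E$, let $1<p\le2$, and suppose $\llbracket\mathcal E\rrbracket<\infty$. Then for every Banach space $X$ and every $f\in L^p(\Omega,X)$ $$\|f\|_{L^p(\Omega,X)}\leq T_p\Big(\|\mathbb E(f|\mathcal F_0)\|_{L^p(\Omega,X)}^p+\sum_{n=1}^{\infty}\|\mathbb E(f|\mathcal F_n)-\mathbb E(f|\mathcal F_{n-1})\|_{L^p(\Omega,X)}^p\Big)^{1/p},$$ where $$T_p=\Big(1+\frac{1}{1-2^{-1/p}}\Big)\,2^{2-\frac1p}\,\big(1+MT_p(\mathbb R)^p\big)^{\frac1p}\,\big(4\llbracket\mathcal E\rrbracket+1\big)^{1-\frac1p}.$$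
   Context: A filtered probability space $(\Omega,\mathcal F,(\mathcal F_n)_{n\ge0},\mathbb P)$: $(\mathcal F_n)_{n\ge0}$ is an increasing sequence of sub-$\sigma$-algebras with $\mathcal F=\sigma(\bigcup_n\mathcal F_n)$, and each $\mathcal F_n$ is generated by a finite partition $\mathcal A_n$ of $\Omega$ into sets of positive probability (atoms), with $\mathcal A_0=\{\Omega\}$. $L^p(\Omega,X)$ is the Bochner space of $p$-integrable $X$-valued functions. Collection $\mathcal E$: for $A\in\mathcal A_n$ write $A=\bigcup_{j=1}^{N(A)}A_j$ with $A_j\in\mathcal A_{n+1}$ pairwise disjoint, ordered so that $\mathbb P(A_j)\ge\mathbb P(A_{j+1})>0$ (one such ordering is fixed), and put $A^{\diamond}=A_1$. Put $\mathcal C_0=\emptyset$, $\mathcal E_0=\mathcal A_0$, and for $n\ge0$, $\mathcal C_{n+1}=\{A^\diamond:A\in\mathcal A_n\}$, $\mathcal E_{n+1}=\mathcal A_{n+1}\setminus\mathcal C_{n+1}$; $\mathcal E=\bigcup_{n\ge0}\mathcal E_n$. Carleson constant: $\llbracket\mathcal R\rrbracket=\sup_{I\in\mathcal R}\frac1{\mathbb P(I)}\sum_{J\in\mathcal R,\,J\subseteq I}\mathbb P(J)$ for a collection $\mathcal R$ of measurable sets of positive probability. $MT_p(\mathbb R)$ is the martingale type $p$ constant of $\mathbb R$: the smallest $C$ such that for every probability space $(\Omega',\mathcal F',\mathbb P')$ with an increasing sequence $(\mathcal F'_n)_{n\ge0}$ of purely atomic sub-$\sigma$-algebras with $\mathcal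 F'=\sigma(\bigcup_n\mathcal F'_n)$ and every real $f\in L^p(\Omega')$, $\|f\|_{L^p}\le C\big(\|\mathbb E(f|\mathcal F'_0)\|_{L^p}^p+\sum_{n\ge1}\|\mathbb E(f|\mathcal F'_n)-\mathbb E(f|\mathcal F'_{n-1})\|_{L^p}^p\big)^{1/p}$; it is known to be finite for $1<p\le2$. *)

theory Defs
  imports "HOL-Probability.Probability"
begin

section \<open>Powers in the extended half-line and norms\<close>

text \<open>Intended for exponents \<open>a > 0\<close>, so that \<open>\<infinity>\<close> raised to the power \<open>a\<close> is \<open>\<infinity>\<close>.\<close>

definition epowr :: "ennreal \<Rightarrow> real \<Rightarrow> ennreal" where
  "epowr x a = (if x = \<infinity> then \<infinity> else ennreal (enn2real x powr a))"

definition Lp_norm :: "real \<Rightarrow> 'a measure \<Rightarrow> ('a \<Rightarrow> 'b::real_normed_vector) \<Rightarrow> ennreal" where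
  "Lp_norm p M f = epowr (\<integral>\<^sup>+x. ennreal (norm (f x) powr p) \<partial>M) (1 / p)"


section \<open>Bochner integration in arbitrary Banach spaces\<close>

text \<open>
  The constant \<^const>\<open>has_bochner_integral\<close> is restricted to second countable spaces. The
  following definitions repeat it for Banach spaces that need not be separable, with Borel
  measurability replaced by strong measurability; the lemmas below show that both notions agree
  with the library where the latter is available.
\<close>

definition strongly_measurable :: "'a measure \<Rightarrow> ('a \<Rightarrow> 'b::topological_space) \<Rightarrow> bool" where
  "strongly_measurable M f \<longleftrightarrow>
     (\<exists>s. (\<forall>i. simple_function M (s i)) \<and> (\<forall>x\<in>space M. (\<lambda>i. s i x) \<longlonglongrightarrow> f x))"

definition has_strong_integral :: "'a measure \<Rightarrow> ('a \<Rightarrow> 'b::real_normed_vector) \<Rightarrow> 'b \<Rightarrow> bool" where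
  "has_strong_integral M f x \<longleftrightarrow> strongly_measurable M f \<and>
     (\<exists>s. (\<forall>i. Bochner_Integration.simple_bochner_integrable M (s i)) \<and>
          (\<lambda>i. \<integral>\<^sup>+y. ennreal (norm (f y - s i y)) \<partial>M) \<longlonglongrightarrow> 0 \<and>
          (\<lambda>i. Bochner_Integration.simple_bochner_integral M (s i)) \<longlonglongrightarrow> x)"

lemma strongly_measurable_iff_borel:
  fixes f :: "'a \<Rightarrow> 'b::{real_normed_vector, second_countable_topology}"
  shows "strongly_measurable M f \<longleftrightarrow> f \<in> borel_measurable M"
proof
  assume "strongly_measurable M f"
  then obtain s where s: "\<And>i. simple_function M (s i)"
    and lim: "\<And>x. x \<in> space M \<Longrightarrow> (\<lambda>i. s i x) \<longlonglongrightarrow> f x"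
    unfolding strongly_measurable_def by blast
  show "f \<in> borel_measurable M"
    by (rule borel_measurable_LIMSEQ_metric[OF borel_measurable_simple_function[OF s] lim])
next
  assume "f \<in> borel_measurable M"
  from borel_measurable_implies_sequence_metric[OF this, of 0]
  show "strongly_measurable M f"
    unfolding strongly_measurable_def by blast
qed

lemma has_strong_integral_iff_has_bochner_integral:
  fixes f :: "'a \<Rightarrow> 'b::{real_normed_vector, second_countable_topology}"
  shows "has_strong_integral M f x \<longleftrightarrow> has_bochner_integral M f x"
  unfolding has_strong_integral_def strongly_measurable_iff_borel has_bochner_integral.simps
  by auto

definition Lp :: "real \<Rightarrow> 'a measure \<Rightarrow> ('a \<Rightarrow> 'b::real_normed_vector) set" where
  "Lp p M = {f. strongly_measurable M f \<and> Lp_norm p M f < \<infinity>}"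

text \<open>For every \<open>A\<close> in the sub-\<open>\<sigma>\<close>-algebra, the integrals of \<open>f\<close> and of \<open>g\<close> over \<open>A\<close> exist and
  coincide (with value \<open>y\<close>).\<close>

definition is_cond_exp ::
    "'a measure \<Rightarrow> 'a measure \<Rightarrow> ('a \<Rightarrow> 'b::real_normed_vector) \<Rightarrow> ('a \<Rightarrow> 'b) \<Rightarrow> bool" where
  "is_cond_exp M F f g \<longleftrightarrow> strongly_measurable F g \<and>
     (\<forall>A\<in>sets F. \<exists>y. has_strong_integral M (\<lambda>x. indicator A x *\<^sub>R f x) y \<and>
                       has_strong_integral M (\<lambda>x. indicator A x *\<^sub>R g x) y)"

definition cond_exp ::
    "'a measure \<Rightarrow> 'a measure \<Rightarrow> ('a \<Rightarrow> 'b::real_normed_vector) \<Rightarrow> 'a \<Rightarrow> 'b" where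
  "cond_exp M F f = (SOME g. is_cond_exp M F f g)"


section \<open>Filtered probability spaces\<close>

locale filtered_prob_space = prob_space M + filtration "space M" F
  for M :: "'a measure" and F :: "nat \<Rightarrow> 'a measure" +
  assumes subalg: "\<And>n. subalgebra M (F n)"
    and sets_eq_sigma: "sets M = sigma_sets (space M) (\<Union>n. sets (F n))"

text \<open>
  \<open>ch n A\<close> lists the sets \<open>A\<^sub>1, \<dots>, A\<^bsub>N(A)\<^esub>\<close> of \<open>\<A> (n + 1)\<close> contained in \<open>A \<in> \<A> n\<close>, by
  decreasing probability. The level \<open>n\<close> is an argument because the same set may be an atom of
  several levels.
\<close>

locale finite_atomic_filtration = filtered_prob_space M F
  for M :: "'a measure" and F :: "nat \<Rightarrow> 'a measure" +
  fixes \<A> :: "nat \<Rightarrow> 'a set set" and ch :: "nat \<Rightarrow> 'a set \<Rightarrow> 'a set list"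
  assumes finite_atoms: "\<And>n. finite (\<A> n)"
    and partition_atoms: "\<And>n. partition_on (space M) (\<A> n)"
    and sets_F_eq: "\<And>n. sets (F n) = sigma_sets (space M) (\<A> n)"
    and prob_atoms_pos: "\<And>n A. A \<in> \<A> n \<Longrightarrow> prob A > 0"
    and atoms_0: "\<A> 0 = {space M}"
    and distinct_ch: "\<And>n A. A \<in> \<A> n \<Longrightarrow> distinct (ch n A)"
    and set_ch: "\<And>n A. A \<in> \<A> n \<Longrightarrow> set (ch n A) = {B \<in> \<A> (Suc n). B \<subseteq> A}"
    and sorted_ch: "\<And>n A. A \<in> \<A> n \<Longrightarrow> sorted_wrt (\<lambda>B B'. prob B \<ge> prob B') (ch n A)"

definition diamond :: "(nat \<Rightarrow> 'a set \<Rightarrow> 'a set list) \<Rightarrow> nat \<Rightarrow> 'a set \<Rightarrow> 'a set" where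
  "diamond ch n A = hd (ch n A)"

fun C_level :: "(nat \<Rightarrow> 'a set set) \<Rightarrow> (nat \<Rightarrow> 'a set \<Rightarrow> 'a set list) \<Rightarrow> nat \<Rightarrow> 'a set set" where
  "C_level \<A> ch 0 = {}"
| "C_level \<A> ch (Suc n) = {diamond ch n A | A. A \<in> \<A> n}"

definition E_level :: "(nat \<Rightarrow> 'a set set) \<Rightarrow> (nat \<Rightarrow> 'a set \<Rightarrow> 'a set list) \<Rightarrow> nat \<Rightarrow> 'a set set" where
  "E_level \<A> ch n = \<A> n - C_level \<A> ch n"

definition E_coll :: "(nat \<Rightarrow> 'a set set) \<Rightarrow> (nat \<Rightarrow> 'a set \<Rightarrow> 'a set list) \<Rightarrow> 'a set set" where
  "E_coll \<A> ch = (\<Union>n. E_level \<A> ch n)"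

definition carleson :: "'a measure \<Rightarrow> 'a set set \<Rightarrow> ennreal" where
  "carleson M R = (SUP I\<in>R. (\<Sum>\<^sub>\<infinity>J\<in>{J\<in>R. J \<subseteq> I}. emeasure M J) / emeasure M I)"


section \<open>Martingale type of the real line\<close>

definition atom_of :: "'a measure \<Rightarrow> 'a measure \<Rightarrow> 'a set \<Rightarrow> bool" where
  "atom_of M F A \<longleftrightarrow> A \<in> sets F \<and> measure M A > 0 \<and>
     (\<forall>B\<in>sets F. B \<subseteq> A \<longrightarrow> measure M B = 0 \<or> measure M B = measure M A)"

definition purely_atomic :: "'a measure \<Rightarrow> 'a measure \<Rightarrow> bool" where
  "purely_atomic M F \<longleftrightarrow> (\<forall>A\<in>sets F. measure M A > 0 \<longrightarrow> (\<exists>B\<subseteq>A. atom_of M F B))"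

text \<open>
  The least admissible constant, an element of \<open>[0,\<infinity>]\<close>. A definition cannot quantify over all
  types, so the probability spaces range over all measures (arbitrary carrier, arbitrary
  \<open>\<sigma>\<close>-algebra) on the type \<^typ>\<open>nat \<Rightarrow> nat\<close>. This gives the same constant as probability spaces
  on arbitrary types: up to null sets each \<open>F n\<close> is generated by a countable partition into
  atoms, so the filtration and \<open>f\<close> factor through the map that sends a point to the sequence of
  indices of the atoms containing it.
\<close>

definition MT_real :: "real \<Rightarrow> ennreal" where
  "MT_real p = Inf {C. \<forall>(M :: (nat \<Rightarrow> nat) measure) F (f :: (nat \<Rightarrow> nat) \<Rightarrow> real).
     filtered_prob_space M F \<longrightarrow> (\<forall>n. purely_atomic M (F n)) \<longrightarrow>
     f \<in> borel_measurable M \<longrightarrow> Lp_norm p M f < \<infinity> \<longrightarrow>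
     Lp_norm p M f \<le> C *
       epowr (epowr (Lp_norm p M (real_cond_exp M (F 0) f)) p +
              (\<Sum>n. epowr (Lp_norm p M (\<lambda>x. real_cond_exp M (F (Suc n)) f x -
                                           real_cond_exp M (F n) f x)) p)) (1 / p)}"

definition T_const :: "real \<Rightarrow> ennreal \<Rightarrow> ennreal" where
  "T_const p K =
     ennreal ((1 + 1 / (1 - 2 powr (- 1 / p))) * 2 powr (2 - 1 / p)) *
     epowr (1 + epowr (MT_real p) p) (1 / p) * epowr (4 * K + 1) (1 - 1 / p)"

end

theory Submission
  imports Defs
begin

text \<open>
  Write \<open>f\<^sub>n\<close> for the conditional expectation of \<open>f\<close> given \<open>F n\<close>, \<open>d\<^sub>n\<close> for the increments of
  \<open>f\<^sub>n\<close> (with \<open>d\<^sub>0 = f\<^sub>0\<close>) and \<open>S\<^sub>n\<close> for the sum of the norms of \<open>d\<^sub>0, \<dots>, d\<^sub>n\<close>. The geometry of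
  an arbitrary Banach space gives no cancellation in \<open>f\<^sub>n\<close>, so the \<open>p\<close>-th moment of \<open>S\<^sub>n\<close>
  itself is estimated; the finite Carleson constant \<open>K\<close> of \<open>\<E>\<close> makes this possible.

  For \<open>1 < p \<le> 2\<close> one has \<open>(s + t)\<^sup>p \<le> s\<^sup>p + p t s\<^sup>p\<^sup>-\<^sup>1 + t\<^sup>p\<close>. With \<open>s = S\<^sub>n\<^sub>-\<^sub>1\<close> and
  \<open>t\<close> the norm of \<open>d\<^sub>n\<close>, the last terms sum to the right-hand side of the theorem, and the
  mixed terms remain. On an atom \<open>A\<close> of level \<open>n - 1\<close> the weight \<open>S\<^sub>n\<^sub>-\<^sub>1\<close> is constant and \<open>d\<^sub>n\<close>
  has integral zero. Hence the integral of the norm of \<open>d\<^sub>n\<close> over the single child \<open>A\<^sup>\<diamond>\<close> is at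
  most its integral over the other children, which are exactly the children in \<open>\<E>\<close>: up to a
  factor \<open>2\<close>, the mixed term may be integrated only over the union \<open>U\<^sub>n\<close> of level \<open>n\<close> of \<open>\<E>\<close>
  (lemma \<open>martingale_difference_concentrates\<close>). There Young's inequality splits it into a multiple
  of the \<open>p\<close>-th power of the norm of \<open>d\<^sub>n\<close> and \<open>S\<^sub>n\<^sub>-\<^sub>1\<^sup>p / c\<close>. Since \<open>S\<^sub>n\<close> increases with \<open>n\<close>,
  summation by parts and the Carleson condition bound the sum over \<open>n \<le> N\<close> of the integrals of
  \<open>S\<^sub>n\<^sub>-\<^sub>1\<^sup>p\<close> over \<open>U\<^sub>n\<close> by \<open>K\<close> times the integral of \<open>S\<^sub>N\<^sup>p\<close> (lemma
  \<open>carleson_increasing_process\<close>). With \<open>c = 4 K\<close> this contribution is half of the quantity to be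
  estimated and can be absorbed, which bounds the \<open>p\<close>-th moment of \<open>S\<^sub>N\<close> by
  \<open>6 (4 K + 1)\<^sup>p\<^sup>-\<^sup>1\<close> times the sum of the \<open>p\<close>-th moments of the increments (lemma
  \<open>integral_powr_sum_norm_le\<close>).

  The rest is soft. The \<open>p\<close>-th root of this constant is at most \<open>6 (4 K + 1)\<^sup>1\<^sup>-\<^sup>1\<^sup>/\<^sup>p\<close>, and already
  the numerical factor of \<open>T\<^sub>p\<close> is at least \<open>6\<close>, while the factor containing the martingale type
  constant is at least \<open>1\<close>. Finally \<open>f\<^sub>n\<close> tends to \<open>f\<close> in \<open>L\<^sup>1\<close>, hence almost everywhere
  along a subsequence, and Fatou's lemma transfers the bound from \<open>f\<^sub>n\<close> to \<open>f\<close>.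
\<close>

section \<open>Strong measurability and the Bochner integral\<close>

lemma strongly_measurable_simple:
  "simple_function M f \<Longrightarrow> strongly_measurable M f"
  unfolding strongly_measurable_def by (intro exI[of _ "\<lambda>_. f"]) simp

lemma strongly_measurable_comp2:
  fixes f :: "'a \<Rightarrow> 'b::topological_space" and g :: "'a \<Rightarrow> 'c::topological_space"
    and h :: "'b \<Rightarrow> 'c \<Rightarrow> 'd::topological_space"
  assumes "strongly_measurable M f" "strongly_measurable M g"
    and h: "\<And>u v a b. u \<longlonglongrightarrow> a \<Longrightarrow> v \<longlonglongrightarrow> b \<Longrightarrow> (\<lambda>i::nat. h (u i) (v i)) \<longlonglongrightarrow> h a b"
  shows "strongly_measurable M (\<lambda>x. h (f x) (g x))"
proof -
  from assms obtain s t where "\<And>i. simple_function M (s i)" "\<And>i. simple_function M (t i)"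
    "\<And>x. x \<in> space M \<Longrightarrow> (\<lambda>i. s i x) \<longlonglongrightarrow> f x" "\<And>x. x \<in> space M \<Longrightarrow> (\<lambda>i. t i x) \<longlonglongrightarrow> g x"
    unfolding strongly_measurable_def by blast
  then show ?thesis
    unfolding strongly_measurable_def
    by (intro exI[of _ "\<lambda>i x. h (s i x) (t i x)"]) (auto intro: simple_function_compose2 h)
qed

lemma strongly_measurable_diff:
  fixes f g :: "'a \<Rightarrow> 'b::real_normed_vector"
  shows "strongly_measurable M f \<Longrightarrow> strongly_measurable M g \<Longrightarrow>
    strongly_measurable M (\<lambda>x. f x - g x)"
  by (erule strongly_measurable_comp2) (auto intro: tendsto_diff)

lemma strongly_measurable_add:
  fixes f g :: "'a \<Rightarrow> 'b::real_normed_vector"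
  shows "strongly_measurable M f \<Longrightarrow> strongly_measurable M g \<Longrightarrow>
    strongly_measurable M (\<lambda>x. f x + g x)"
  by (erule strongly_measurable_comp2) (auto intro: tendsto_add)

lemma strongly_measurable_indicator_scaleR:
  fixes f :: "'a \<Rightarrow> 'b::real_normed_vector"
  assumes "A \<in> sets M" "strongly_measurable M f"
  shows "strongly_measurable M (\<lambda>x. indicat_real A x *\<^sub>R f x)"
  by (rule strongly_measurable_comp2[OF strongly_measurable_simple[OF simple_function_indicator[OF assms(1)]] assms(2)])
     (auto intro: tendsto_scaleR)

lemma strongly_measurable_norm:
  fixes f :: "'a \<Rightarrow> 'b::real_normed_vector"
  assumes "strongly_measurable M f"
  shows "(\<lambda>x. norm (f x)) \<in> borel_measurable M"
proof -
  have "strongly_measurable M (\<lambda>x. norm (f x))"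
    by (rule strongly_measurable_comp2[OF assms assms]) (auto intro: tendsto_norm)
  then show ?thesis by (simp add: strongly_measurable_iff_borel)
qed

lemma strongly_measurable_norm_diff:
  fixes f g :: "'a \<Rightarrow> 'b::real_normed_vector"
  shows "strongly_measurable M f \<Longrightarrow> strongly_measurable M g \<Longrightarrow>
    (\<lambda>x. norm (f x - g x)) \<in> borel_measurable M"
  by (intro strongly_measurable_norm strongly_measurable_diff)

lemma strongly_measurable_simple_bochner_integrable:
  "Bochner_Integration.simple_bochner_integrable M s \<Longrightarrow> strongly_measurable M s"
  by (auto elim: simple_bochner_integrable.cases intro: strongly_measurable_simple)

lemma nn_integral_norm_diff_triangle:
  fixes f g h :: "'a \<Rightarrow> 'b::real_normed_vector"
  assumes "strongly_measurable M f" "strongly_measurable M g" "strongly_measurable M h"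
  shows "(\<integral>\<^sup>+x. ennreal (norm (f x - h x)) \<partial>M) \<le>
    (\<integral>\<^sup>+x. ennreal (norm (f x - g x)) \<partial>M) + (\<integral>\<^sup>+x. ennreal (norm (g x - h x)) \<partial>M)"
proof -
  note [measurable] = strongly_measurable_norm_diff[OF assms(1,2)]
    strongly_measurable_norm_diff[OF assms(2,3)]
  have "(\<integral>\<^sup>+x. ennreal (norm (f x - h x)) \<partial>M) \<le>
      (\<integral>\<^sup>+x. ennreal (norm (f x - g x)) + ennreal (norm (g x - h x)) \<partial>M)"
    by (intro nn_integral_mono)
       (metis diff_add_cancel add_diff_eq norm_triangle_ineq ennreal_leI ennreal_plus norm_ge_zero)
  also have "\<dots> = (\<integral>\<^sup>+x. ennreal (norm (f x - g x)) \<partial>M) + (\<integral>\<^sup>+x. ennreal (norm (g x - h x)) \<partial>M)"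
    by (rule nn_integral_add) auto
  finally show ?thesis .
qed

lemma simple_bochner_integral_diff_le:
  fixes s t :: "'a \<Rightarrow> 'b::real_normed_vector"
  assumes "Bochner_Integration.simple_bochner_integrable M s"
    and "Bochner_Integration.simple_bochner_integrable M t"
  shows "ennreal (norm (Bochner_Integration.simple_bochner_integral M s -
      Bochner_Integration.simple_bochner_integral M t)) \<le> (\<integral>\<^sup>+x. ennreal (norm (s x - t x)) \<partial>M)"
proof -
  have "ennreal (norm (Bochner_Integration.simple_bochner_integral M s -
      Bochner_Integration.simple_bochner_integral M t)) =
      ennreal (norm (Bochner_Integration.simple_bochner_integral M (\<lambda>x. s x - t x)))"
    using assms by (subst simple_bochner_integral_diff) auto
  also have "\<dots> \<le> ennreal (Bochner_Integration.simple_bochner_integral M (\<lambda>x. norm (s x - t x)))"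
    using simple_bochner_integrable_compose2[of "(-)" M s t] assms
    by (auto intro!: simple_bochner_integral_norm_bound ennreal_leI)
  also have "\<dots> = (\<integral>\<^sup>+x. ennreal (norm (s x - t x)) \<partial>M)"
    using simple_bochner_integrable_compose2[of "\<lambda>x y. norm (x - y)" M s t] assms
    by (auto intro!: simple_bochner_integral_eq_nn_integral)
  finally show ?thesis .
qed

text \<open>
  The stability estimate from which the other properties of the integral follow. In particular
  the value of the integral does not depend on the approximating simple functions.
\<close>

lemma has_strong_integral_dist_le:
  fixes f g :: "'a \<Rightarrow> 'b::real_normed_vector"
  assumes f: "has_strong_integral M f x" and g: "has_strong_integral M g y"
  shows "ennreal (norm (x - y)) \<le> (\<integral>\<^sup>+z. ennreal (norm (f z - g z)) \<partial>M)"
proof -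
  from f obtain s where sf: "strongly_measurable M f"
    and s: "\<And>i. Bochner_Integration.simple_bochner_integrable M (s i)"
    and s0: "(\<lambda>i. \<integral>\<^sup>+y. ennreal (norm (f y - s i y)) \<partial>M) \<longlonglongrightarrow> 0"
    and sx: "(\<lambda>i. Bochner_Integration.simple_bochner_integral M (s i)) \<longlonglongrightarrow> x"
    unfolding has_strong_integral_def by blast
  from g obtain t where tg: "strongly_measurable M g"
    and t: "\<And>i. Bochner_Integration.simple_bochner_integrable M (t i)"
    and t0: "(\<lambda>i. \<integral>\<^sup>+y. ennreal (norm (g y - t i y)) \<partial>M) \<longlonglongrightarrow> 0"
    and tx: "(\<lambda>i. Bochner_Integration.simple_bochner_integral M (t i)) \<longlonglongrightarrow> y"
    unfolding has_strong_integral_def by blast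
  note [intro] = sf tg strongly_measurable_simple_bochner_integrable[OF s] strongly_measurable_simple_bochner_integrable[OF t]
  let ?I = "\<integral>\<^sup>+z. ennreal (norm (f z - g z)) \<partial>M"
  have le: "ennreal (norm (Bochner_Integration.simple_bochner_integral M (s i) -
      Bochner_Integration.simple_bochner_integral M (t i))) \<le>
      (\<integral>\<^sup>+y. ennreal (norm (f y - s i y)) \<partial>M) + (?I + (\<integral>\<^sup>+y. ennreal (norm (g y - t i y)) \<partial>M))" for i
  proof -
    have "(\<integral>\<^sup>+x. ennreal (norm (s i x - t i x)) \<partial>M) \<le> (\<integral>\<^sup>+x. ennreal (norm (s i x - f x)) \<partial>M) +
        (\<integral>\<^sup>+x. ennreal (norm (f x - t i x)) \<partial>M)"
      by (rule nn_integral_norm_diff_triangle) auto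
    also have "\<dots> \<le> (\<integral>\<^sup>+x. ennreal (norm (s i x - f x)) \<partial>M) +
        (?I + (\<integral>\<^sup>+y. ennreal (norm (g y - t i y)) \<partial>M))"
      by (intro add_left_mono nn_integral_norm_diff_triangle) auto
    also have "(\<integral>\<^sup>+x. ennreal (norm (s i x - f x)) \<partial>M) = (\<integral>\<^sup>+x. ennreal (norm (f x - s i x)) \<partial>M)"
      by (simp add: norm_minus_commute)
    finally show ?thesis using simple_bochner_integral_diff_le[OF s t, of i i] by order
  qed
  have "(\<lambda>i. ennreal (norm (Bochner_Integration.simple_bochner_integral M (s i) -
      Bochner_Integration.simple_bochner_integral M (t i)))) \<longlonglongrightarrow> ennreal (norm (x - y))"
    by (intro tendsto_ennrealI tendsto_norm tendsto_diff sx tx)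
  moreover have "(\<lambda>i. (\<integral>\<^sup>+y. ennreal (norm (f y - s i y)) \<partial>M) +
      (?I + (\<integral>\<^sup>+y. ennreal (norm (g y - t i y)) \<partial>M))) \<longlonglongrightarrow> 0 + (?I + 0)"
    by (intro tendsto_add s0 t0 tendsto_const)
  ultimately show ?thesis
    using LIMSEQ_le le by fastforce
qed

lemma has_strong_integral_unique:
  fixes f :: "'a \<Rightarrow> 'b::real_normed_vector"
  assumes "has_strong_integral M f x" "has_strong_integral M f y"
  shows "x = y"
  using has_strong_integral_dist_le[OF assms] by simp

lemma has_strong_integral_add:
  fixes f g :: "'a \<Rightarrow> 'b::real_normed_vector"
  assumes f: "has_strong_integral M f x" and g: "has_strong_integral M g y"
  shows "has_strong_integral M (\<lambda>z. f z + g z) (x + y)"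
proof -
  from f obtain s where sf: "strongly_measurable M f"
    and s: "\<And>i. Bochner_Integration.simple_bochner_integrable M (s i)"
    and s0: "(\<lambda>i. \<integral>\<^sup>+y. ennreal (norm (f y - s i y)) \<partial>M) \<longlonglongrightarrow> 0"
    and sx: "(\<lambda>i. Bochner_Integration.simple_bochner_integral M (s i)) \<longlonglongrightarrow> x"
    unfolding has_strong_integral_def by blast
  from g obtain t where tg: "strongly_measurable M g"
    and t: "\<And>i. Bochner_Integration.simple_bochner_integrable M (t i)"
    and t0: "(\<lambda>i. \<integral>\<^sup>+y. ennreal (norm (g y - t i y)) \<partial>M) \<longlonglongrightarrow> 0"
    and tx: "(\<lambda>i. Bochner_Integration.simple_bochner_integral M (t i)) \<longlonglongrightarrow> y"
    unfolding has_strong_integral_def by blast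
  note [measurable] = strongly_measurable_norm_diff[OF sf strongly_measurable_simple_bochner_integrable[OF s]]
    strongly_measurable_norm_diff[OF tg strongly_measurable_simple_bochner_integrable[OF t]]
  have le: "(\<integral>\<^sup>+z. ennreal (norm (f z + g z - (s i z + t i z))) \<partial>M) \<le>
      (\<integral>\<^sup>+y. ennreal (norm (f y - s i y)) \<partial>M) + (\<integral>\<^sup>+y. ennreal (norm (g y - t i y)) \<partial>M)" for i
  proof -
    have "(\<integral>\<^sup>+z. ennreal (norm (f z + g z - (s i z + t i z))) \<partial>M) \<le>
        (\<integral>\<^sup>+z. ennreal (norm (f z - s i z)) + ennreal (norm (g z - t i z)) \<partial>M)"
      by (auto intro!: nn_integral_mono norm_diff_triangle_ineq ennreal_leI simp flip: ennreal_plus)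
    also have "\<dots> = (\<integral>\<^sup>+y. ennreal (norm (f y - s i y)) \<partial>M) + (\<integral>\<^sup>+y. ennreal (norm (g y - t i y)) \<partial>M)"
      by (rule nn_integral_add) auto
    finally show ?thesis .
  qed
  have "(\<lambda>i. \<integral>\<^sup>+z. ennreal (norm (f z + g z - (s i z + t i z))) \<partial>M) \<longlonglongrightarrow> 0"
    by (rule tendsto_sandwich[OF _ _ tendsto_const])
       (use tendsto_add[OF s0 t0] le in auto)
  moreover have "(\<lambda>i. Bochner_Integration.simple_bochner_integral M (\<lambda>z. s i z + t i z)) \<longlonglongrightarrow> x + y"
    using tendsto_add[OF sx tx] by (simp add: simple_bochner_integral_add s t)
  moreover have "Bochner_Integration.simple_bochner_integrable M (\<lambda>z. s i z + t i z)" for i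
    using s t by (simp add: simple_bochner_integrable_compose2)
  ultimately show ?thesis
    unfolding has_strong_integral_def using strongly_measurable_add[OF sf tg]
    by (intro conjI exI[of _ "\<lambda>i z. s i z + t i z"]) auto
qed

lemma has_strong_integral_zero: "has_strong_integral M (\<lambda>_. 0::'b::real_normed_vector) 0"
proof -
  have "Bochner_Integration.simple_bochner_integrable M (\<lambda>_. 0::'b)"
    by (intro simple_bochner_integrable.intros) auto
  moreover have "Bochner_Integration.simple_bochner_integral M (\<lambda>_. 0::'b) = 0"
    unfolding simple_bochner_integral_def by (rule sum.neutral) auto
  ultimately show ?thesis
    unfolding has_strong_integral_def
    by (intro conjI exI[of _ "\<lambda>i z. 0"]) (auto intro: strongly_measurable_simple)
qed

lemma has_strong_integral_sum:
  fixes f :: "'i \<Rightarrow> 'a \<Rightarrow> 'b::real_normed_vector"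
  assumes "finite I" "\<And>i. i \<in> I \<Longrightarrow> has_strong_integral M (f i) (y i)"
  shows "has_strong_integral M (\<lambda>x. \<Sum>i\<in>I. f i x) (\<Sum>i\<in>I. y i)"
  using assms by (induction I rule: finite_induct) (auto intro: has_strong_integral_add has_strong_integral_zero)

lemma (in finite_measure) simple_bochner_integrable_simple_function:
  "simple_function M s \<Longrightarrow> Bochner_Integration.simple_bochner_integrable M s"
  by (intro simple_bochner_integrable.intros) auto

lemma (in finite_measure) has_strong_integral_indicator:
  fixes c :: "'b::real_normed_vector"
  assumes A: "A \<in> sets M"
  shows "has_strong_integral M (\<lambda>x. indicat_real A x *\<^sub>R c) (measure M A *\<^sub>R c)"
proof -
  have i: "Bochner_Integration.simple_bochner_integrable M (indicat_real A)"
    by (intro simple_bochner_integrable_simple_function simple_function_indicator A)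
  have "Bochner_Integration.simple_bochner_integral M (indicat_real A) = measure M A"
    using simple_bochner_integral_eq_nn_integral[OF i] A
    by (simp add: ennreal_indicator emeasure_eq_measure)
  then have *: "Bochner_Integration.simple_bochner_integral M (\<lambda>x. indicat_real A x *\<^sub>R c) = measure M A *\<^sub>R c"
    using simple_bochner_integral_linear[OF _ i, of "\<lambda>r. r *\<^sub>R c"]
    by (simp add: bounded_linear.linear bounded_linear_scaleR_left)
  have s: "simple_function M (\<lambda>x. indicat_real A x *\<^sub>R c)"
    by (rule simple_function_compose1[OF simple_function_indicator[OF A]])
  show ?thesis
    unfolding has_strong_integral_def
    by (intro conjI exI[of _ "\<lambda>i x. indicat_real A x *\<^sub>R c"])
       (auto intro: strongly_measurable_simple s simple_bochner_integrable_simple_function simp: *)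
qed

text \<open>
  Pointwise approximation by simple functions becomes approximation in \<open>L\<^sup>1\<close> after truncation:
  an approximant is replaced by \<open>0\<close> wherever its error exceeds the norm of \<open>f\<close>. The truncated
  functions are still simple, still converge pointwise, and their error is dominated by the
  integrable norm of \<open>f\<close>.
\<close>

lemma strongly_measurable_L1_approx:
  fixes f :: "'a \<Rightarrow> 'b::real_normed_vector"
  assumes f: "strongly_measurable M f" and fin: "(\<integral>\<^sup>+x. ennreal (norm (f x)) \<partial>M) < \<infinity>"
  shows "\<exists>s. (\<forall>i. simple_function M (s i)) \<and> (\<lambda>i. \<integral>\<^sup>+x. ennreal (norm (f x - s i x)) \<partial>M) \<longlonglongrightarrow> 0"
proof -
  from f obtain s where s: "\<And>i. simple_function M (s i)"
    and lim: "\<And>x. x \<in> space M \<Longrightarrow> (\<lambda>i. s i x) \<longlonglongrightarrow> f x"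
    unfolding strongly_measurable_def by blast
  note [measurable] = strongly_measurable_norm[OF f]
    strongly_measurable_norm_diff[OF f strongly_measurable_simple[OF s]]
  \<comment> \<open>outside the zeros of f the condition holds eventually; at zeros of f it forces t i x = 0\<close>
  define t where "t i x = (if norm (f x - s i x) \<le> norm (f x) then s i x else 0)" for i x
  have t: "simple_function M (t i)" for i
    unfolding t_def by (intro simple_function_If s simple_function_const) measurable
  note [measurable] = strongly_measurable_norm_diff[OF f strongly_measurable_simple[OF t]]
  have tlim: "(\<lambda>i. norm (f x - t i x)) \<longlonglongrightarrow> 0" if x: "x \<in> space M" for x
  proof (rule tendsto_sandwich[OF _ _ tendsto_const])
    have d: "(\<lambda>i. norm (f x - s i x)) \<longlonglongrightarrow> 0"
      using tendsto_norm[OF tendsto_diff[OF tendsto_const[of "f x"] lim[OF x]]] by simp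
    then show "(\<lambda>i. norm (f x - s i x)) \<longlonglongrightarrow> 0" .
    show "\<forall>\<^sub>F i in sequentially. norm (f x - t i x) \<le> norm (f x - s i x)"
    proof (cases "f x = 0")
      case True
      then show ?thesis by (auto simp: t_def)
    next
      case False
      with d have "\<forall>\<^sub>F i in sequentially. norm (f x - s i x) < norm (f x)"
        by (intro order_tendstoD(2)[OF d]) auto
      then show ?thesis by eventually_elim (auto simp: t_def)
    qed
  qed auto
  have "(\<lambda>i. \<integral>\<^sup>+x. ennreal (norm (f x - t i x)) \<partial>M) \<longlonglongrightarrow> (\<integral>\<^sup>+x. 0 \<partial>M)"
  proof (rule nn_integral_dominated_convergence[where w="\<lambda>x. ennreal (norm (f x))"])
    show "AE x in M. (\<lambda>i. ennreal (norm (f x - t i x))) \<longlonglongrightarrow> 0"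
      using tlim by (intro AE_I2) (simp flip: ennreal_0 add: tendsto_ennrealI)
    show "AE x in M. ennreal (norm (f x - t j x)) \<le> ennreal (norm (f x))" for j
      by (intro AE_I2 ennreal_leI) (auto simp: t_def)
  qed (use fin in auto)
  with t show ?thesis by auto
qed

lemma (in finite_measure) has_strong_integral_exists:
  fixes f :: "'a \<Rightarrow> 'b::banach"
  assumes f: "strongly_measurable M f" and fin: "(\<integral>\<^sup>+x. ennreal (norm (f x)) \<partial>M) < \<infinity>"
  shows "\<exists>y. has_strong_integral M f y"
proof -
  obtain s where s: "\<And>i. simple_function M (s i)"
    and lim: "(\<lambda>i. \<integral>\<^sup>+x. ennreal (norm (f x - s i x)) \<partial>M) \<longlonglongrightarrow> 0"
    using strongly_measurable_L1_approx[OF assms] by blast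
  let ?I = "\<lambda>i. Bochner_Integration.simple_bochner_integral M (s i)"
  have "Cauchy ?I"
  proof (rule CauchyI)
    fix e :: real assume e: "0 < e"
    have "\<forall>\<^sub>F i in sequentially. (\<integral>\<^sup>+x. ennreal (norm (f x - s i x)) \<partial>M) < ennreal (e/2)"
      by (rule order_tendstoD(2)[OF lim]) (use e in auto)
    then obtain N where N: "\<And>i. i \<ge> N \<Longrightarrow> (\<integral>\<^sup>+x. ennreal (norm (f x - s i x)) \<partial>M) < ennreal (e/2)"
      by (auto simp: eventually_sequentially)
    have "norm (?I m - ?I n) < e" if "m \<ge> N" "n \<ge> N" for m n
    proof -
      have "ennreal (norm (?I m - ?I n)) \<le> (\<integral>\<^sup>+x. ennreal (norm (s m x - s n x)) \<partial>M)"
        by (intro simple_bochner_integral_diff_le simple_bochner_integrable_simple_function s)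
      also have "\<dots> \<le> (\<integral>\<^sup>+x. ennreal (norm (s m x - f x)) \<partial>M) + (\<integral>\<^sup>+x. ennreal (norm (f x - s n x)) \<partial>M)"
        by (intro nn_integral_norm_diff_triangle f strongly_measurable_simple s)
      also have "\<dots> < ennreal (e/2) + ennreal (e/2)"
        using N[OF that(1)] N[OF that(2)] by (intro add_strict_mono) (auto simp: norm_minus_commute)
      also have "\<dots> = ennreal e" using e by (simp flip: ennreal_plus)
      finally show ?thesis using e by (simp add: ennreal_less_iff)
    qed
    then show "\<exists>M. \<forall>m\<ge>M. \<forall>n\<ge>M. norm (?I m - ?I n) < e" by blast
  qed
  then obtain y where "?I \<longlonglongrightarrow> y"
    using Cauchy_convergent convergent_def by blast
  then show ?thesis
    unfolding has_strong_integral_def using f lim s simple_bochner_integrable_simple_function by blast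
qed

section \<open>Functions that are constant on atoms\<close>

definition level_const :: "'a set set \<Rightarrow> ('a \<Rightarrow> 'b) \<Rightarrow> bool" where
  "level_const \<P> \<phi> \<longleftrightarrow> (\<forall>A\<in>\<P>. \<forall>x\<in>A. \<forall>y\<in>A. \<phi> x = \<phi> y)"

text \<open>
  Functions that are constant on the atoms of a level are evaluated at a chosen point of each atom,
  so that their integrals become finite sums.
\<close>

definition rep :: "'a set \<Rightarrow> 'a" where
  "rep A = (SOME x. x \<in> A)"

lemma level_const_const [simp]: "level_const \<P> (\<lambda>_. c)"
  by (simp add: level_const_def)

lemma level_const_comp: "level_const \<P> f \<Longrightarrow> level_const \<P> (\<lambda>x. h (f x))"
  unfolding level_const_def by metis

lemma level_const_comp2:
  "level_const \<P> f \<Longrightarrow> level_const \<P> g \<Longrightarrow> level_const \<P> (\<lambda>x. h (f x) (g x))"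
  unfolding level_const_def by (intro ballI arg_cong2[where f=h]) blast+

lemma level_const_sum:
  "(\<And>i. i \<in> I \<Longrightarrow> level_const \<P> (f i)) \<Longrightarrow> level_const \<P> (\<lambda>x. \<Sum>i\<in>I. f i x)"
  unfolding level_const_def by (intro ballI sum.cong) blast+

context finite_atomic_filtration
begin

lemma atom_in_F: "A \<in> \<A> n \<Longrightarrow> A \<in> sets (F n)"
  unfolding sets_F_eq by (rule sigma_sets.Basic)

lemma sets_F_M: "A \<in> sets (F n) \<Longrightarrow> A \<in> sets M"
  using subalg[of n] by (auto simp: subalgebra_def)

lemma atom_in_M [simp]: "A \<in> \<A> n \<Longrightarrow> A \<in> sets M"
  using atom_in_F sets_F_M by blast

lemma atom_subset_space: "A \<in> \<A> n \<Longrightarrow> A \<subseteq> space M"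
  using partition_atoms[of n] by (auto simp: partition_on_def)

lemma atom_nonempty: "A \<in> \<A> n \<Longrightarrow> A \<noteq> {}"
  using partition_atoms[of n] by (auto simp: partition_on_def)

lemma rep_in: "A \<in> \<A> n \<Longrightarrow> rep A \<in> A"
  unfolding rep_def using atom_nonempty by (simp add: some_in_eq)

lemma atom_eq: "A \<in> \<A> n \<Longrightarrow> B \<in> \<A> n \<Longrightarrow> x \<in> A \<Longrightarrow> x \<in> B \<Longrightarrow> A = B"
  using partition_atoms[of n] by (auto simp: partition_on_def disjoint_def)

lemma atom_cover: "x \<in> space M \<Longrightarrow> \<exists>A\<in>\<A> n. x \<in> A"
  using partition_atoms[of n] by (auto simp: partition_on_def)

lemma atom_dichotomy:
  assumes "U \<in> sets (F n)" and A: "A \<in> \<A> n"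
  shows "A \<subseteq> U \<or> A \<inter> U = {}"
proof -
  from assms(1) have "U \<in> sigma_sets (space M) (\<A> n)" by (simp add: sets_F_eq)
  then show ?thesis
  proof induction
    case (Basic a)
    then show ?case using atom_eq[OF A] by blast
  next
    case (Compl a)
    then show ?case using atom_subset_space[OF A] by blast
  qed blast+
qed

lemma F_mono: "m \<le> n \<Longrightarrow> A \<in> sets (F m) \<Longrightarrow> A \<in> sets (F n)"
  using sets_F_mono by blast

lemma atom_nested:
  assumes "m \<le> n" "A \<in> \<A> m" "B \<in> \<A> n" "x \<in> A" "x \<in> B"
  shows "B \<subseteq> A"
  using atom_dichotomy[OF F_mono[OF assms(1) atom_in_F[OF assms(2)]] assms(3)] assms(4,5) by blast

lemma level_const_mono:
  assumes "m \<le> n" "level_const (\<A> m) f"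
  shows "level_const (\<A> n) f"
  unfolding level_const_def
proof (intro ballI)
  fix B x y assume B: "B \<in> \<A> n" "x \<in> B" "y \<in> B"
  obtain A where A: "A \<in> \<A> m" "x \<in> A" using atom_cover[of x m] atom_subset_space B by blast
  then have "B \<subseteq> A" using atom_nested[OF assms(1) A(1) B(1)] B(2) by blast
  then have "x \<in> A" "y \<in> A" using B by auto
  with assms(2) A(1) show "f x = f y" unfolding level_const_def by blast
qed

lemma level_const_rep:
  "level_const (\<A> n) f \<Longrightarrow> A \<in> \<A> n \<Longrightarrow> x \<in> A \<Longrightarrow> f x = f (rep A)"
  unfolding level_const_def using rep_in by blast

lemma level_const_rep_sub:
  "level_const (\<A> n) f \<Longrightarrow> A \<in> \<A> n \<Longrightarrow> B \<in> \<A> m \<Longrightarrow> B \<subseteq> A \<Longrightarrow> f (rep B) = f (rep A)"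
  using level_const_rep rep_in by blast

text \<open>
  A measurable set of level \<open>n\<close> contains an atom or misses it. Hence a simple function of that level
  is constant on atoms, and so is a pointwise limit of such functions.
\<close>

lemma strongly_measurable_level_const:
  fixes f :: "'a \<Rightarrow> 'b::t2_space"
  assumes "strongly_measurable (F n) f"
  shows "level_const (\<A> n) f"
  unfolding level_const_def
proof (intro ballI)
  fix A x y assume A: "A \<in> \<A> n" and x: "x \<in> A" and y: "y \<in> A"
  have sp: "x \<in> space (F n)" "y \<in> space (F n)"
    using A x y atom_subset_space space_F by auto
  from assms obtain s where s: "\<And>i. simple_function (F n) (s i)"
    and lim: "\<And>x. x \<in> space (F n) \<Longrightarrow> (\<lambda>i. s i x) \<longlonglongrightarrow> f x"
    unfolding strongly_measurable_def by blast
  have "s i x = s i y" for i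
  proof -
    have "s i -` {s i x} \<inter> space (F n) \<in> sets (F n)"
      using s[of i] by (rule simple_functionD)
    from atom_dichotomy[OF this A] show ?thesis using x y sp by auto
  qed
  then show "f x = f y"
    using LIMSEQ_unique[OF lim[OF sp(1)]] lim[OF sp(2)] by simp
qed

lemma level_const_simple_F:
  assumes "level_const (\<A> n) f"
  shows "simple_function (F n) f"
  unfolding simple_function_def
proof (intro conjI ballI)
  have "f ` space (F n) \<subseteq> (\<lambda>A. f (rep A)) ` \<A> n"
  proof
    fix y assume "y \<in> f ` space (F n)"
    then obtain x where x: "x \<in> space M" "y = f x" by (auto simp: space_F)
    then obtain A where "A \<in> \<A> n" "x \<in> A" using atom_cover by blast
    with level_const_rep[OF assms this] x show "y \<in> (\<lambda>A. f (rep A)) ` \<A> n" by blast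
  qed
  then show "finite (f ` space (F n))"
    using finite_atoms finite_subset by blast
  fix y
  have "f -` {y} \<inter> space (F n) = \<Union>{A\<in>\<A> n. f (rep A) = y}"
  proof (intro equalityI subsetI)
    fix x assume "x \<in> f -` {y} \<inter> space (F n)"
    then have x: "x \<in> space M" "f x = y" by (auto simp: space_F)
    then obtain A where A: "A \<in> \<A> n" "x \<in> A" using atom_cover by blast
    with level_const_rep[OF assms A] x show "x \<in> \<Union>{A\<in>\<A> n. f (rep A) = y}"
      by (intro UnionI[of A]) auto
  next
    fix x assume "x \<in> \<Union>{A\<in>\<A> n. f (rep A) = y}"
    then obtain A where A: "A \<in> \<A> n" "x \<in> A" "f (rep A) = y" by blast
    then have "x \<in> space (F n)" using atom_subset_space[of A n] space_F[of n] by blast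
    then show "x \<in> f -` {y} \<inter> space (F n)" using level_const_rep[OF assms A(1,2)] A(3) by simp
  qed
  then show "f -` {y} \<inter> space (F n) \<in> sets (F n)"
    using finite_atoms[of n] atom_in_F by (auto intro!: sets.finite_Union)
qed

lemma level_const_simple:
  assumes "level_const (\<A> n) f"
  shows "simple_function M f"
  using level_const_simple_F[OF assms] unfolding simple_function_def space_F by (meson sets_F_M)

lemma level_const_strongly_measurable:
  "level_const (\<A> n) f \<Longrightarrow> strongly_measurable M f"
  by (intro strongly_measurable_simple level_const_simple)

lemma level_const_integrable:
  fixes \<phi> :: "'a \<Rightarrow> real"
  assumes "level_const (\<A> n) \<phi>"
  shows "integrable M \<phi>"
  by (intro integrableI_simple_bochner_integrable simple_bochner_integrable_simple_function level_const_simple[OF assms])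

lemma level_const_decompose:
  fixes \<phi> :: "'a \<Rightarrow> 'b::real_vector"
  assumes "level_const (\<A> n) \<phi>" "x \<in> space M"
  shows "\<phi> x = (\<Sum>A\<in>\<A> n. indicat_real A x *\<^sub>R \<phi> (rep A))"
proof -
  obtain A where A: "A \<in> \<A> n" "x \<in> A" using atom_cover assms by blast
  have "(\<Sum>B\<in>\<A> n. indicat_real B x *\<^sub>R \<phi> (rep B)) = (\<Sum>B\<in>\<A> n. if B = A then \<phi> (rep A) else 0)"
  proof (intro sum.cong refl)
    fix B assume B: "B \<in> \<A> n"
    show "indicat_real B x *\<^sub>R \<phi> (rep B) = (if B = A then \<phi> (rep A) else 0)"
      using A atom_eq[OF A(1) B A(2)] by (cases "x \<in> B") auto
  qed
  also have "\<dots> = \<phi> x" using A finite_atoms level_const_rep[OF assms(1)] by simp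
  finally show ?thesis by simp
qed

lemma level_const_integral:
  fixes \<phi> :: "'a \<Rightarrow> real"
  assumes "level_const (\<A> n) \<phi>"
  shows "integral\<^sup>L M \<phi> = (\<Sum>A\<in>\<A> n. prob A * \<phi> (rep A))"
proof -
  have "integral\<^sup>L M \<phi> = integral\<^sup>L M (\<lambda>x. \<Sum>A\<in>\<A> n. indicat_real A x *\<^sub>R \<phi> (rep A))"
    by (intro Bochner_Integration.integral_cong level_const_decompose assms) auto
  also have "\<dots> = (\<Sum>A\<in>\<A> n. integral\<^sup>L M (\<lambda>x. indicat_real A x *\<^sub>R \<phi> (rep A)))"
    by (intro Bochner_Integration.integral_sum) (auto intro!: integrable_real_mult_indicator simp: emeasure_eq_measure)
  also have "\<dots> = (\<Sum>A\<in>\<A> n. prob A * \<phi> (rep A))"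
    by (intro sum.cong) (auto simp: emeasure_eq_measure)
  finally show ?thesis .
qed

lemma Union_atoms_within:
  assumes "A \<in> sets (F n)"
  shows "\<Union>{B\<in>\<A> n. B \<subseteq> A} = A"
proof (intro equalityI subsetI)
  fix x assume x: "x \<in> A"
  then have "x \<in> space M" using sets.sets_into_space[OF assms] space_F by blast
  then obtain B where "B \<in> \<A> n" "x \<in> B" using atom_cover by blast
  then show "x \<in> \<Union>{B\<in>\<A> n. B \<subseteq> A}" using atom_dichotomy[OF assms] x by blast
qed auto

lemma sum_atoms_refine:
  fixes g :: "'a set \<Rightarrow> 'b::comm_monoid_add"
  assumes "m \<le> n"
  shows "(\<Sum>B\<in>\<A> n. g B) = (\<Sum>A\<in>\<A> m. \<Sum>B\<in>{B\<in>\<A> n. B \<subseteq> A}. g B)"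
proof -
  have "\<A> n = (\<Union>A\<in>\<A> m. {B\<in>\<A> n. B \<subseteq> A})"
  proof (intro equalityI subsetI)
    fix B assume B: "B \<in> \<A> n"
    then obtain A where "A \<in> \<A> m" "rep B \<in> A"
      using rep_in atom_subset_space atom_cover[of "rep B" m] by blast
    then show "B \<in> (\<Union>A\<in>\<A> m. {B\<in>\<A> n. B \<subseteq> A})"
      using atom_nested[OF assms _ B _ rep_in[OF B]] B by blast
  qed auto
  then have "(\<Sum>B\<in>\<A> n. g B) = (\<Sum>B\<in>(\<Union>A\<in>\<A> m. {B\<in>\<A> n. B \<subseteq> A}). g B)" by simp
  also have "\<dots> = (\<Sum>A\<in>\<A> m. \<Sum>B\<in>{B\<in>\<A> n. B \<subseteq> A}. g B)"
  proof (rule sum.UNION_disjoint)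
    show "\<forall>i\<in>\<A> m. \<forall>j\<in>\<A> m. i \<noteq> j \<longrightarrow> {B \<in> \<A> n. B \<subseteq> i} \<inter> {B \<in> \<A> n. B \<subseteq> j} = {}"
      using rep_in atom_eq[of _ m] by blast
  qed (use finite_atoms in auto)
  finally show ?thesis .
qed

lemma disjoint_subatoms: "disjoint_family_on (\<lambda>B. B) {B \<in> \<A> n. B \<subseteq> A}"
  unfolding disjoint_family_on_def using atom_eq[of _ n] by blast

lemma finite_subatoms: "finite {B \<in> \<A> n. B \<subseteq> A}"
  using finite_atoms by simp

lemma prob_atoms_within:
  assumes "A \<in> sets (F n)"
  shows "(\<Sum>B\<in>{B\<in>\<A> n. B \<subseteq> A}. prob B) = prob A"
proof -
  have "prob (\<Union>B\<in>{B\<in>\<A> n. B \<subseteq> A}. B) = (\<Sum>B\<in>{B\<in>\<A> n. B \<subseteq> A}. prob B)"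
    by (rule finite_measure_finite_Union[OF finite_subatoms _ disjoint_subatoms]) auto
  then show ?thesis using Union_atoms_within[OF assms] by simp
qed

lemma indicator_atoms_within:
  assumes "A \<in> sets (F n)"
  shows "indicat_real A x = (\<Sum>B\<in>{B\<in>\<A> n. B \<subseteq> A}. indicator B x)"
proof -
  have "indicat_real (\<Union>B\<in>{B\<in>\<A> n. B \<subseteq> A}. B) x = (\<Sum>B\<in>{B\<in>\<A> n. B \<subseteq> A}. indicator B x)"
    by (rule indicator_UN_disjoint[OF finite_subatoms disjoint_subatoms])
  then show ?thesis using Union_atoms_within[OF assms] by simp
qed

lemma atom_in_later_F: "m \<le> n \<Longrightarrow> A \<in> \<A> m \<Longrightarrow> A \<in> sets (F n)"
  using F_mono atom_in_F by blast

lemma level_const_indicator: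
  "U \<in> sets (F n) \<Longrightarrow> level_const (\<A> n) (indicat_real U)"
  unfolding level_const_def using atom_dichotomy[of U n] by (fastforce simp: indicator_def)

lemma level_const_nn_integral:
  assumes "level_const (\<A> n) \<phi>" "\<And>x. 0 \<le> \<phi> x"
  shows "(\<integral>\<^sup>+x. ennreal (\<phi> x) \<partial>M) = ennreal (\<Sum>A\<in>\<A> n. prob A * \<phi> (rep A))"
  using nn_integral_eq_integral[OF level_const_integrable[OF assms(1)]] assms(2)
  by (simp add: level_const_integral[OF assms(1)])

section \<open>Conditional expectations and their convergence\<close>

lemma set_strong_integral_exists:
  fixes f :: "'a \<Rightarrow> 'b::banach"
  assumes f: "strongly_measurable M f" and fin: "(\<integral>\<^sup>+x. ennreal (norm (f x)) \<partial>M) < \<infinity>"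
    and A: "A \<in> sets M"
  shows "\<exists>y. has_strong_integral M (\<lambda>x. indicat_real A x *\<^sub>R f x) y"
proof (rule has_strong_integral_exists[OF strongly_measurable_indicator_scaleR[OF A f]])
  have "(\<integral>\<^sup>+x. ennreal (norm (indicat_real A x *\<^sub>R f x)) \<partial>M) \<le> (\<integral>\<^sup>+x. ennreal (norm (f x)) \<partial>M)"
    by (intro nn_integral_mono) (auto simp: indicator_def)
  then show "(\<integral>\<^sup>+x. ennreal (norm (indicat_real A x *\<^sub>R f x)) \<partial>M) < \<infinity>" using fin by order
qed

text \<open>
  The filtration is atomic, so the conditional expectation is the average of \<open>f\<close> over each atom,
  which exists because \<open>X\<close> is complete.
\<close>

lemma is_cond_exp_exists:
  fixes f :: "'a \<Rightarrow> 'b::banach"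
  assumes f: "strongly_measurable M f" and fin: "(\<integral>\<^sup>+x. ennreal (norm (f x)) \<partial>M) < \<infinity>"
  shows "\<exists>g. is_cond_exp M (F n) f g"
proof -
  define I where "I A = (SOME y. has_strong_integral M (\<lambda>x. indicat_real A x *\<^sub>R f x) y)" for A
  have I: "has_strong_integral M (\<lambda>x. indicat_real A x *\<^sub>R f x) (I A)" if "A \<in> \<A> n" for A
    unfolding I_def by (rule someI_ex[OF set_strong_integral_exists[OF f fin atom_in_M[OF that]]])
  define c where "c A = (1 / prob A) *\<^sub>R I A" for A
  define g where "g x = (\<Sum>A\<in>\<A> n. indicat_real A x *\<^sub>R c A)" for x
  have g_lc: "level_const (\<A> n) g"
    unfolding g_def
    by (intro level_const_sum level_const_comp[where h="\<lambda>r. r *\<^sub>R c _"] level_const_indicator atom_in_F)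
  have g_atom: "g x = c A" if A: "A \<in> \<A> n" "x \<in> A" for A x
  proof -
    have "g x = (\<Sum>B\<in>\<A> n. if B = A then c A else 0)"
      unfolding g_def
    proof (intro sum.cong refl)
      fix B assume B: "B \<in> \<A> n"
      show "indicat_real B x *\<^sub>R c B = (if B = A then c A else 0)"
        using A atom_eq[OF A(1) B A(2)] by (cases "x \<in> B") auto
    qed
    then show ?thesis using A finite_atoms by simp
  qed
  have "is_cond_exp M (F n) f g"
    unfolding is_cond_exp_def
  proof (intro conjI ballI)
    show "strongly_measurable (F n) g"
      by (intro strongly_measurable_simple level_const_simple_F g_lc)
    fix U assume U: "U \<in> sets (F n)"
    let ?S = "{A\<in>\<A> n. A \<subseteq> U}"
    have "has_strong_integral M (\<lambda>x. \<Sum>A\<in>?S. indicat_real A x *\<^sub>R f x) (\<Sum>A\<in>?S. I A)"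
      by (intro has_strong_integral_sum finite_subatoms I) auto
    then have 1: "has_strong_integral M (\<lambda>x. indicat_real U x *\<^sub>R f x) (\<Sum>A\<in>?S. I A)"
      by (simp add: indicator_atoms_within[OF U] scaleR_sum_left)
    have "has_strong_integral M (\<lambda>x. \<Sum>A\<in>?S. indicat_real A x *\<^sub>R c A) (\<Sum>A\<in>?S. prob A *\<^sub>R c A)"
      by (intro has_strong_integral_sum finite_subatoms has_strong_integral_indicator) auto
    also have "(\<Sum>A\<in>?S. prob A *\<^sub>R c A) = (\<Sum>A\<in>?S. I A)"
      by (intro sum.cong) (auto simp: c_def dest: prob_atoms_pos)
    also have "(\<lambda>x. \<Sum>A\<in>?S. indicat_real A x *\<^sub>R c A) = (\<lambda>x. \<Sum>A\<in>?S. indicat_real A x *\<^sub>R g x)"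
      by (intro ext sum.cong) (auto simp: indicator_def g_atom)
    finally have "has_strong_integral M (\<lambda>x. indicat_real U x *\<^sub>R g x) (\<Sum>A\<in>?S. I A)"
      by (simp add: indicator_atoms_within[OF U] scaleR_sum_left)
    with 1 show "\<exists>y. has_strong_integral M (\<lambda>x. indicat_real U x *\<^sub>R f x) y \<and>
        has_strong_integral M (\<lambda>x. indicat_real U x *\<^sub>R g x) y" by blast
  qed
  then show ?thesis by blast
qed

lemma is_cond_exp_cond_exp:
  fixes f :: "'a \<Rightarrow> 'b::banach"
  assumes "strongly_measurable M f" "(\<integral>\<^sup>+x. ennreal (norm (f x)) \<partial>M) < \<infinity>"
  shows "is_cond_exp M (F n) f (cond_exp M (F n) f)"
  unfolding cond_exp_def by (rule someI_ex[OF is_cond_exp_exists[OF assms]])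

lemma cond_exp_level_const:
  fixes f :: "'a \<Rightarrow> 'b::banach"
  assumes "strongly_measurable M f" "(\<integral>\<^sup>+x. ennreal (norm (f x)) \<partial>M) < \<infinity>"
  shows "level_const (\<A> n) (cond_exp M (F n) f)"
  using is_cond_exp_cond_exp[OF assms, of n]
  by (auto simp: is_cond_exp_def intro: strongly_measurable_level_const)

lemma has_strong_integral_level_const_atom:
  fixes g :: "'a \<Rightarrow> 'b::banach"
  assumes g: "level_const (\<A> n) g" and A: "A \<in> \<A> n"
  shows "has_strong_integral M (\<lambda>x. indicat_real A x *\<^sub>R g x) (prob A *\<^sub>R g (rep A))"
proof -
  have eq: "(\<lambda>x. indicat_real A x *\<^sub>R g x) = (\<lambda>x. indicat_real A x *\<^sub>R g (rep A))"
  proof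
    fix x show "indicat_real A x *\<^sub>R g x = indicat_real A x *\<^sub>R g (rep A)"
      using level_const_rep[OF g A, of x] by (cases "x \<in> A") simp_all
  qed
  show ?thesis
    unfolding eq using has_strong_integral_indicator[OF atom_in_M[OF A]] .
qed

text \<open>
  Every version of the conditional expectation, in particular the one chosen by
  \<^const>\<open>cond_exp\<close>, has the average of \<open>f\<close> over an atom as its value there, because atoms have
  positive probability.
\<close>

lemma cond_exp_atom:
  fixes f :: "'a \<Rightarrow> 'b::banach"
  assumes f: "strongly_measurable M f" "(\<integral>\<^sup>+x. ennreal (norm (f x)) \<partial>M) < \<infinity>"
    and A: "A \<in> \<A> n"
  shows "has_strong_integral M (\<lambda>x. indicat_real A x *\<^sub>R f x) (prob A *\<^sub>R cond_exp M (F n) f (rep A))"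
proof -
  let ?g = "cond_exp M (F n) f"
  obtain y where y: "has_strong_integral M (\<lambda>x. indicat_real A x *\<^sub>R f x) y"
      "has_strong_integral M (\<lambda>x. indicat_real A x *\<^sub>R ?g x) y"
    using is_cond_exp_cond_exp[OF f, of n] atom_in_F[OF A] unfolding is_cond_exp_def by blast
  have "y = prob A *\<^sub>R ?g (rep A)"
    by (rule has_strong_integral_unique[OF y(2) has_strong_integral_level_const_atom[OF cond_exp_level_const[OF f] A]])
  with y(1) show ?thesis by simp
qed

text \<open>
  The increments have mean zero on every atom of the coarser level: both terms integrate to the
  integral of \<open>f\<close> over that atom.
\<close>

lemma cond_exp_martingale:
  fixes f :: "'a \<Rightarrow> 'b::banach"
  assumes f: "strongly_measurable M f" "(\<integral>\<^sup>+x. ennreal (norm (f x)) \<partial>M) < \<infinity>"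
    and A: "A \<in> \<A> n"
  shows "(\<Sum>B\<in>{B\<in>\<A> (Suc n). B \<subseteq> A}. prob B *\<^sub>R
    (cond_exp M (F (Suc n)) f (rep B) - cond_exp M (F n) f (rep B))) = 0"
proof -
  let ?S = "{B\<in>\<A> (Suc n). B \<subseteq> A}" and ?f = "\<lambda>n. cond_exp M (F n) f"
  have AF: "A \<in> sets (F (Suc n))" by (rule atom_in_later_F[OF _ A]) simp
  have "has_strong_integral M (\<lambda>x. \<Sum>B\<in>?S. indicat_real B x *\<^sub>R f x) (\<Sum>B\<in>?S. prob B *\<^sub>R ?f (Suc n) (rep B))"
    by (intro has_strong_integral_sum finite_subatoms cond_exp_atom f) auto
  then have "has_strong_integral M (\<lambda>x. indicat_real A x *\<^sub>R f x) (\<Sum>B\<in>?S. prob B *\<^sub>R ?f (Suc n) (rep B))"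
    by (simp add: indicator_atoms_within[OF AF] scaleR_sum_left)
  from has_strong_integral_unique[OF this cond_exp_atom[OF f A]]
  have "(\<Sum>B\<in>?S. prob B *\<^sub>R ?f (Suc n) (rep B)) = prob A *\<^sub>R ?f n (rep A)" .
  also have "\<dots> = (\<Sum>B\<in>?S. prob B *\<^sub>R ?f n (rep A))"
    by (simp add: prob_atoms_within[OF AF] flip: scaleR_sum_left)
  also have "\<dots> = (\<Sum>B\<in>?S. prob B *\<^sub>R ?f n (rep B))"
    by (intro sum.cong) (auto simp: level_const_rep_sub[OF cond_exp_level_const[OF f] A])
  finally show ?thesis by (simp add: scaleR_diff_right sum_subtractf)
qed

text \<open>
  On each atom, averaging does not increase the distance to a constant; the atomwise estimates are
  added up.
\<close>

lemma cond_exp_L1_contraction: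
  fixes f h :: "'a \<Rightarrow> 'b::banach"
  assumes f: "strongly_measurable M f" "(\<integral>\<^sup>+x. ennreal (norm (f x)) \<partial>M) < \<infinity>"
    and h: "level_const (\<A> n) h"
  shows "(\<integral>\<^sup>+x. ennreal (norm (cond_exp M (F n) f x - h x)) \<partial>M) \<le> (\<integral>\<^sup>+x. ennreal (norm (f x - h x)) \<partial>M)"
proof -
  let ?g = "cond_exp M (F n) f"
  note [measurable] = strongly_measurable_norm_diff[OF f(1) level_const_strongly_measurable[OF h]]
  have "(\<integral>\<^sup>+x. ennreal (norm (?g x - h x)) \<partial>M) = ennreal (\<Sum>A\<in>\<A> n. prob A * norm (?g (rep A) - h (rep A)))"
    by (rule level_const_nn_integral)
       (auto intro: level_const_comp2[where h="\<lambda>u v. norm (u - v)"] cond_exp_level_const f h)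
  also have "\<dots> = (\<Sum>A\<in>\<A> n. ennreal (prob A * norm (?g (rep A) - h (rep A))))"
    by simp
  also have "\<dots> \<le> (\<Sum>A\<in>\<A> n. \<integral>\<^sup>+x. ennreal (norm (f x - h x)) * indicator A x \<partial>M)"
  proof (intro sum_mono)
    fix A assume A: "A \<in> \<A> n"
    have "ennreal (prob A * norm (?g (rep A) - h (rep A))) =
        ennreal (norm (prob A *\<^sub>R ?g (rep A) - prob A *\<^sub>R h (rep A)))"
      by (simp flip: scaleR_diff_right)
    also have "\<dots> \<le> (\<integral>\<^sup>+x. ennreal (norm (indicat_real A x *\<^sub>R f x - indicat_real A x *\<^sub>R h x)) \<partial>M)"
      by (rule has_strong_integral_dist_le[OF cond_exp_atom[OF f A] has_strong_integral_level_const_atom[OF h A]])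
    also have "\<dots> = (\<integral>\<^sup>+x. ennreal (norm (f x - h x)) * indicator A x \<partial>M)"
      by (intro nn_integral_cong) (auto simp: indicator_def)
    finally show "ennreal (prob A * norm (?g (rep A) - h (rep A))) \<le> \<dots>" .
  qed
  also have "\<dots> = (\<integral>\<^sup>+x. (\<Sum>A\<in>\<A> n. ennreal (norm (f x - h x)) * indicator A x) \<partial>M)"
    by (rule nn_integral_sum[symmetric])
       (intro borel_measurable_times_ennreal borel_measurable_indicator atom_in_M; measurable)
  also have "\<dots> = (\<integral>\<^sup>+x. ennreal (norm (f x - h x)) \<partial>M)"
  proof (intro nn_integral_cong)
    fix x assume "x \<in> space M"
    then obtain A where A: "A \<in> \<A> n" "x \<in> A" using atom_cover by blast
    have "(\<Sum>B\<in>\<A> n. ennreal (norm (f x - h x)) * indicator B x) =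
        (\<Sum>B\<in>\<A> n. if B = A then ennreal (norm (f x - h x)) else 0)"
    proof (intro sum.cong refl)
      fix B assume B: "B \<in> \<A> n"
      show "ennreal (norm (f x - h x)) * indicator B x = (if B = A then ennreal (norm (f x - h x)) else 0)"
        using A atom_eq[OF A(1) B A(2)] by (cases "x \<in> B") auto
    qed
    then show "(\<Sum>B\<in>\<A> n. ennreal (norm (f x - h x)) * indicator B x) = ennreal (norm (f x - h x))"
      using A finite_atoms by simp
  qed
  finally show ?thesis .
qed

text \<open>
  The sets with arbitrarily good approximations in probability from the levels of the filtration form
  a \<open>\<sigma>\<close>-algebra: for a countable union, continuity from below leaves finitely many sets, and their
  approximants lie in one common level.
\<close>

lemma sets_approx_by_filtration:
  assumes "B \<in> sets M" "0 < e"
  shows "\<exists>n. \<exists>U\<in>sets (F n). prob (sym_diff B U) < e"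
proof -
  from assms(1) have "B \<in> sigma_sets (space M) (\<Union>n. sets (F n))" by (simp add: sets_eq_sigma)
  then show ?thesis using assms(2)
  proof (induction arbitrary: e)
    case (Basic a)
    then obtain n where "a \<in> sets (F n)" by blast
    then show ?case using Basic.prems by (intro exI[of _ n] bexI[of _ a]) auto
  next
    case Empty
    then show ?case by (intro exI[of _ 0] bexI[of _ "{}"]) auto
  next
    case (Compl a)
    then obtain n U where U: "U \<in> sets (F n)" "prob (sym_diff a U) < e" by blast
    have sub: "a \<subseteq> space M"
      using sigma_sets_into_sp[OF _ Compl.hyps] sets.space_closed sets_F_M by blast
    have "U \<subseteq> space M" using sets.sets_into_space[OF U(1)] by (simp add: space_F)
    with sub have "sym_diff (space M - a) (space M - U) = sym_diff a U" by blast
    then show ?case using U sets.compl_sets[OF U(1)]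
      by (intro exI[of _ n] bexI[of _ "space M - U"]) (auto simp: space_F)
  next
    case (Union a)
    have a: "a i \<in> sets M" for i using Union.hyps by (simp add: sets_eq_sigma)
    have "incseq (\<lambda>k. \<Union>i<k. a i)" by (intro monoI UN_mono) auto
    then have "(\<lambda>k. prob (\<Union>i<k. a i)) \<longlonglongrightarrow> prob (\<Union>k. \<Union>i<k. a i)"
      by (intro finite_Lim_measure_incseq) (use a in auto)
    also have "(\<Union>k. \<Union>i<k. a i) = (\<Union>i. a i)" by blast
    finally have lim: "(\<lambda>k. prob (\<Union>i<k. a i)) \<longlonglongrightarrow> prob (\<Union>i. a i)" .
    have "\<forall>\<^sub>F k in sequentially. prob (\<Union>i. a i) - e / 2 < prob (\<Union>i<k. a i)"
      by (rule order_tendstoD(1)[OF lim]) (use Union.prems in simp)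
    then obtain k where k: "prob (\<Union>i. a i) - e / 2 < prob (\<Union>i<k. a i)"
      by (auto simp: eventually_sequentially)
    have "\<exists>n. \<exists>U\<in>sets (F n). prob (sym_diff (a i) U) < e / (2 * (k + 1))" for i
      using Union.prems by (intro Union.IH) auto
    then obtain n U where U: "\<And>i. U i \<in> sets (F (n i))" "\<And>i. prob (sym_diff (a i) (U i)) < e / (2 * (k + 1))"
      by metis
    define m where "m = Max (n ` {..k})"
    have UF: "U i \<in> sets (F m)" if "i < k" for i
      by (rule F_mono[OF _ U(1)]) (use that in \<open>auto simp: m_def intro!: Max_ge\<close>)
    let ?U = "\<Union>i<k. U i"
    have [measurable]: "U i \<in> sets M" "a i \<in> sets M" for i using U(1) sets_F_M a by auto
    have "prob (sym_diff (\<Union>i. a i) ?U) \<le>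
        prob (((\<Union>i. a i) - (\<Union>i<k. a i)) \<union> (\<Union>i<k. sym_diff (a i) (U i)))"
      by (intro finite_measure_mono) auto
    also have "\<dots> \<le> prob ((\<Union>i. a i) - (\<Union>i<k. a i)) + prob (\<Union>i<k. sym_diff (a i) (U i))"
      by (rule measure_Un_le) auto
    also have "prob ((\<Union>i. a i) - (\<Union>i<k. a i)) = prob (\<Union>i. a i) - prob (\<Union>i<k. a i)"
      by (rule finite_measure_Diff) auto
    also have "\<dots> < e / 2" using k by simp
    also have "prob (\<Union>i<k. sym_diff (a i) (U i)) \<le> (\<Sum>i<k. prob (sym_diff (a i) (U i)))"
      by (rule measure_UNION_le) auto
    also have "\<dots> \<le> (\<Sum>i<k. e / (2 * (k + 1)))"
      by (intro sum_mono less_imp_le U(2))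
    also have "\<dots> \<le> e / 2" using Union.prems by (simp add: field_simps)
    finally have "prob (sym_diff (\<Union>i. a i) ?U) < e" by simp
    moreover have "?U \<in> sets (F m)" using UF by auto
    ultimately show ?case by blast
  qed
qed

lemma simple_sum_approx_by_level_const:
  fixes v :: "'i \<Rightarrow> 'b::banach"
  assumes "finite Y" "\<And>y. y \<in> Y \<Longrightarrow> B y \<in> sets M" "0 < e"
  shows "\<exists>n h. level_const (\<A> n) h \<and>
    (\<integral>\<^sup>+x. ennreal (norm ((\<Sum>y\<in>Y. indicat_real (B y) x *\<^sub>R v y) - h x)) \<partial>M) < ennreal e"
  using assms
proof (induction Y arbitrary: e rule: finite_induct)
  case empty
  then show ?case by (intro exI[of _ 0] exI[of _ "\<lambda>_. 0"]) auto
next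
  case (insert y Y)
  let ?S = "\<lambda>x. \<Sum>y\<in>Y. indicat_real (B y) x *\<^sub>R v y"
  obtain n h where h: "level_const (\<A> n) h" "(\<integral>\<^sup>+x. ennreal (norm (?S x - h x)) \<partial>M) < ennreal (e/2)"
    using insert.IH[of "e/2"] insert.prems by auto
  have By: "B y \<in> sets M" using insert.prems by simp
  have "0 < e / (2 * (norm (v y) + 1))"
    using insert.prems by (intro divide_pos_pos mult_pos_pos add_nonneg_pos) auto
  from sets_approx_by_filtration[OF By this]
  obtain m U where U: "U \<in> sets (F m)" "prob (sym_diff (B y) U) < e / (2 * (norm (v y) + 1))" by blast
  define k where "k = max n m"
  have k: "level_const (\<A> k) h" "U \<in> sets (F k)"
    using level_const_mono[OF _ h(1), of k] F_mono[OF _ U(1), of k] by (auto simp: k_def)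
  have UM: "U \<in> sets M" using sets_F_M[OF U(1)] .
  let ?h = "\<lambda>x. indicat_real U x *\<^sub>R v y + h x"
  have hk: "level_const (\<A> k) ?h"
    by (rule level_const_comp2[where h="\<lambda>u w. u *\<^sub>R v y + w", OF level_const_indicator[OF k(2)] k(1)])
  have mS: "strongly_measurable M ?S"
  proof (rule strongly_measurable_simple)
    show "simple_function M ?S"
      using insert.prems(1) insert.hyps(1)
      by (intro simple_function_sum simple_function_compose1[where g="\<lambda>r. r *\<^sub>R v _"] simple_function_indicator) auto
  qed
  note [measurable] = strongly_measurable_norm_diff[OF mS level_const_strongly_measurable[OF h(1)]] By UM
  have "(\<integral>\<^sup>+x. ennreal (norm ((\<Sum>y\<in>insert y Y. indicat_real (B y) x *\<^sub>R v y) - ?h x)) \<partial>M) \<le>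
      (\<integral>\<^sup>+x. ennreal (norm (v y)) * indicator (sym_diff (B y) U) x + ennreal (norm (?S x - h x)) \<partial>M)"
  proof (intro nn_integral_mono)
    fix x
    have "(\<Sum>y\<in>insert y Y. indicat_real (B y) x *\<^sub>R v y) - ?h x =
        (indicat_real (B y) x - indicat_real U x) *\<^sub>R v y + (?S x - h x)"
      unfolding sum.insert[OF insert.hyps] by (simp only: scaleR_diff_left add_diff_add)
    also have "norm \<dots> \<le> norm (v y) * indicator (sym_diff (B y) U) x + norm (?S x - h x)"
      by (rule order_trans[OF norm_triangle_ineq]) (auto simp: indicator_def)
    finally have "ennreal (norm ((\<Sum>y\<in>insert y Y. indicat_real (B y) x *\<^sub>R v y) - ?h x)) \<le>
      ennreal (norm (v y) * indicator (sym_diff (B y) U) x + norm (?S x - h x))"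
      by (rule ennreal_leI)
    also have "\<dots> = ennreal (norm (v y)) * indicator (sym_diff (B y) U) x + ennreal (norm (?S x - h x))"
      by (auto simp: indicator_def simp flip: ennreal_plus)
    finally show "ennreal (norm ((\<Sum>y\<in>insert y Y. indicat_real (B y) x *\<^sub>R v y) - ?h x)) \<le> \<dots>" .
  qed
  also have "\<dots> = ennreal (norm (v y)) * emeasure M (sym_diff (B y) U) + (\<integral>\<^sup>+x. ennreal (norm (?S x - h x)) \<partial>M)"
    by (subst nn_integral_add) (auto simp: nn_integral_cmult_indicator)
  also have "\<dots> < ennreal (e/2) + ennreal (e/2)"
  proof (rule add_strict_mono)
    have "norm (v y) * prob (sym_diff (B y) U) \<le> norm (v y) * (e / (2 * (norm (v y) + 1)))"
      using U(2) by (intro mult_left_mono) auto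
    also have "\<dots> < e / 2"
      using insert.prems(2) norm_ge_zero[of "v y"] by (simp add: divide_simps del: norm_ge_zero)
    finally show "ennreal (norm (v y)) * emeasure M (sym_diff (B y) U) < ennreal (e/2)"
      using insert.prems(2) by (simp add: emeasure_eq_measure ennreal_less_iff flip: ennreal_mult)
  qed (rule h)
  also have "\<dots> = ennreal e" using insert.prems(2) by (simp flip: ennreal_plus)
  finally show ?case using hk by blast
qed

lemma L1_approx_by_level_const:
  fixes f :: "'a \<Rightarrow> 'b::banach"
  assumes f: "strongly_measurable M f" "(\<integral>\<^sup>+x. ennreal (norm (f x)) \<partial>M) < \<infinity>" and e: "0 < e"
  shows "\<exists>n h. level_const (\<A> n) h \<and> (\<integral>\<^sup>+x. ennreal (norm (f x - h x)) \<partial>M) < ennreal e"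
proof -
  obtain s where s: "\<And>i. simple_function M (s i)"
    and lim: "(\<lambda>i. \<integral>\<^sup>+x. ennreal (norm (f x - s i x)) \<partial>M) \<longlonglongrightarrow> 0"
    using strongly_measurable_L1_approx[OF f] by blast
  have "\<forall>\<^sub>F i in sequentially. (\<integral>\<^sup>+x. ennreal (norm (f x - s i x)) \<partial>M) < ennreal (e/2)"
    by (rule order_tendstoD(2)[OF lim]) (use e in auto)
  then obtain i where i: "(\<integral>\<^sup>+x. ennreal (norm (f x - s i x)) \<partial>M) < ennreal (e/2)"
    by (auto simp: eventually_sequentially)
  let ?t = "s i"
  have fin: "finite (?t ` space M)" and lv: "\<And>y. ?t -` {y} \<inter> space M \<in> sets M"
    using s[of i] by (auto intro: simple_functionD)
  have rep: "?t x = (\<Sum>y\<in>?t ` space M. indicat_real (?t -` {y} \<inter> space M) x *\<^sub>R y)" if "x \<in> space M" for x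
  proof -
    have "(\<Sum>y\<in>?t ` space M. indicat_real (?t -` {y} \<inter> space M) x *\<^sub>R y) =
        (\<Sum>y\<in>?t ` space M. if y = ?t x then ?t x else 0)"
      using that by (intro sum.cong) (auto simp: indicator_def)
    then show ?thesis using that fin by simp
  qed
  obtain n h where h: "level_const (\<A> n) h"
    "(\<integral>\<^sup>+x. ennreal (norm ((\<Sum>y\<in>?t ` space M. indicat_real (?t -` {y} \<inter> space M) x *\<^sub>R y) - h x)) \<partial>M) < ennreal (e/2)"
    using simple_sum_approx_by_level_const[OF fin, of "\<lambda>y. ?t -` {y} \<inter> space M" "e/2" "\<lambda>y. y"] lv e by auto
  have "(\<integral>\<^sup>+x. ennreal (norm ((\<Sum>y\<in>?t ` space M. indicat_real (?t -` {y} \<inter> space M) x *\<^sub>R y) - h x)) \<partial>M) =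
      (\<integral>\<^sup>+x. ennreal (norm (?t x - h x)) \<partial>M)"
    by (intro nn_integral_cong) (simp flip: rep)
  with h have h2: "(\<integral>\<^sup>+x. ennreal (norm (?t x - h x)) \<partial>M) < ennreal (e/2)" by simp
  have "(\<integral>\<^sup>+x. ennreal (norm (f x - h x)) \<partial>M) \<le>
      (\<integral>\<^sup>+x. ennreal (norm (f x - ?t x)) \<partial>M) + (\<integral>\<^sup>+x. ennreal (norm (?t x - h x)) \<partial>M)"
    by (intro nn_integral_norm_diff_triangle f strongly_measurable_simple s level_const_simple[OF h(1)])
  also have "\<dots> < ennreal (e/2) + ennreal (e/2)"
    by (intro add_strict_mono i h2)
  also have "\<dots> = ennreal e" using e by (simp flip: ennreal_plus)
  finally show ?thesis using h(1) by blast
qed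

text \<open>
  A function constant on the atoms of some level is fixed by all later conditional expectations, and
  such functions are dense in \<open>L\<^sup>1\<close>; contractivity then gives convergence for every \<open>f\<close>.
\<close>

lemma cond_exp_tendsto_L1:
  fixes f :: "'a \<Rightarrow> 'b::banach"
  assumes f: "strongly_measurable M f" "(\<integral>\<^sup>+x. ennreal (norm (f x)) \<partial>M) < \<infinity>"
  shows "integrable M (\<lambda>x. norm (f x - cond_exp M (F n) f x))"
    and "(\<lambda>n. \<integral>x. norm (f x - cond_exp M (F n) f x) \<partial>M) \<longlonglongrightarrow> 0"
proof -
  let ?f = "\<lambda>n. cond_exp M (F n) f"
  have sm: "strongly_measurable M (?f n)" for n
    by (rule level_const_strongly_measurable[OF cond_exp_level_const[OF f]])
  have meas: "(\<lambda>x. norm (f x - ?f n x)) \<in> borel_measurable M" for n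
    by (rule strongly_measurable_norm_diff[OF f(1) sm])
  have close: "\<exists>N. \<forall>n\<ge>N. (\<integral>\<^sup>+x. ennreal (norm (f x - ?f n x)) \<partial>M) < ennreal e" if e: "0 < e" for e
  proof -
    obtain N h where h: "level_const (\<A> N) h" "(\<integral>\<^sup>+x. ennreal (norm (f x - h x)) \<partial>M) < ennreal (e/2)"
      using L1_approx_by_level_const[OF f, of "e/2"] e by auto
    have "(\<integral>\<^sup>+x. ennreal (norm (f x - ?f n x)) \<partial>M) < ennreal e" if n: "N \<le> n" for n
    proof -
      have hn: "level_const (\<A> n) h" by (rule level_const_mono[OF n h(1)])
      have "(\<integral>\<^sup>+x. ennreal (norm (f x - ?f n x)) \<partial>M) \<le>
          (\<integral>\<^sup>+x. ennreal (norm (f x - h x)) \<partial>M) + (\<integral>\<^sup>+x. ennreal (norm (h x - ?f n x)) \<partial>M)"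
        by (intro nn_integral_norm_diff_triangle f(1) sm level_const_strongly_measurable[OF hn])
      also have "(\<integral>\<^sup>+x. ennreal (norm (h x - ?f n x)) \<partial>M) \<le> (\<integral>\<^sup>+x. ennreal (norm (f x - h x)) \<partial>M)"
        using cond_exp_L1_contraction[OF f hn] by (simp add: norm_minus_commute)
      also have "(\<integral>\<^sup>+x. ennreal (norm (f x - h x)) \<partial>M) + (\<integral>\<^sup>+x. ennreal (norm (f x - h x)) \<partial>M) <
          ennreal (e/2) + ennreal (e/2)"
        by (intro add_strict_mono h(2))
      also have "\<dots> = ennreal e" using e by (simp flip: ennreal_plus)
      finally show ?thesis by (simp add: add_left_mono)
    qed
    then show ?thesis by blast
  qed
  have int: "integrable M (\<lambda>x. norm (f x - ?f n x))" for n
  proof (rule integrableI_nonneg[OF meas])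
    have lc: "level_const (\<A> n) (\<lambda>x. norm (?f n x))"
      by (rule level_const_comp[OF cond_exp_level_const[OF f]])
    have "(\<integral>\<^sup>+x. ennreal (norm (f x - ?f n x)) \<partial>M) \<le>
        (\<integral>\<^sup>+x. ennreal (norm (f x - 0)) \<partial>M) + (\<integral>\<^sup>+x. ennreal (norm (0 - ?f n x)) \<partial>M)"
      by (rule nn_integral_norm_diff_triangle[OF f(1) _ sm])
         (rule level_const_strongly_measurable[of 0], simp)
    also have "\<dots> < \<infinity>"
      using f(2) level_const_nn_integral[OF lc] by simp
    finally show "(\<integral>\<^sup>+x. ennreal (norm (f x - ?f n x)) \<partial>M) < \<infinity>" .
  qed auto
  show "integrable M (\<lambda>x. norm (f x - ?f n x))" by (rule int)
  show "(\<lambda>n. \<integral>x. norm (f x - ?f n x) \<partial>M) \<longlonglongrightarrow> 0"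
  proof (rule LIMSEQ_I)
    fix e :: real assume e: "0 < e"
    obtain N where N: "\<And>n. N \<le> n \<Longrightarrow> (\<integral>\<^sup>+x. ennreal (norm (f x - ?f n x)) \<partial>M) < ennreal e"
      using close[OF e] by blast
    have "norm ((\<integral>x. norm (f x - ?f n x) \<partial>M) - 0) < e" if "N \<le> n" for n
    proof -
      have "ennreal (\<integral>x. norm (f x - ?f n x) \<partial>M) < ennreal e"
        using N[OF that] by (subst nn_integral_eq_integral[symmetric, OF int]) auto
      then show ?thesis using e by (simp add: ennreal_less_iff integral_nonneg_AE)
    qed
    then show "\<exists>N. \<forall>n\<ge>N. norm ((\<integral>x. norm (f x - ?f n x) \<partial>M) - 0) < e" by blast
  qed
qed

end

section \<open>Elementary inequalities for powers\<close>

lemma powr_add_le: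
  fixes a s t :: real
  assumes "0 < a" "a \<le> 1" "0 \<le> s" "0 \<le> t"
  shows "(s + t) powr a \<le> s powr a + t powr a"
proof (cases "s = 0 \<or> t = 0")
  case False
  then have st: "0 < s" "0 < t" using assms by auto
  have "(s + t) powr a = s * (s + t) powr (a - 1) + t * (s + t) powr (a - 1)"
    using st powr_mult_base[of "s + t" "a - 1"] by (simp add: distrib_right)
  also have "\<dots> \<le> s * s powr (a - 1) + t * t powr (a - 1)"
    using st assms by (intro add_mono mult_left_mono powr_mono2') auto
  also have "\<dots> = s powr a + t powr a"
    using st powr_mult_base[of s "a - 1"] powr_mult_base[of t "a - 1"] by simp
  finally show ?thesis .
qed auto

text \<open>
  Both sides agree at \<open>t = 0\<close>, and their derivatives in \<open>t\<close> compare by subadditivity of the power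
  \<open>p - 1 \<le> 1\<close>. The sharp coefficient \<open>1\<close> of \<open>s powr p\<close> is what allows the estimate to be summed over
  the steps of a martingale.
\<close>

lemma powr_add_le_tangent:
  fixes p s t :: real
  assumes p: "1 < p" "p \<le> 2" and st: "0 \<le> s" "0 \<le> t"
  shows "(s + t) powr p \<le> s powr p + p * (t * s powr (p - 1)) + t powr p"
proof (cases "s = 0 \<or> t = 0")
  case False
  then have s: "0 < s" and t: "0 < t" using st by auto
  let ?h = "\<lambda>t. s powr p + p * (t * s powr (p - 1)) + t powr p - (s + t) powr p"
  have "?h 0 \<le> ?h t"
  proof (rule DERIV_nonneg_imp_increasing_open[where a=0 and b=t and f="?h"])
    fix x assume x: "0 < x" "x < t"
    have "(?h has_real_derivative p * s powr (p - 1) + p * x powr (p - 1) - p * (s + x) powr (p - 1)) (at x)"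
      using s x by (auto intro!: derivative_eq_intros)
    moreover have "0 \<le> p * (s powr (p - 1) + x powr (p - 1) - (s + x) powr (p - 1))"
      using powr_add_le[of "p - 1" s x] p s x by (intro mult_nonneg_nonneg) auto
    ultimately show "\<exists>y. (?h has_real_derivative y) (at x) \<and> 0 \<le> y"
      by (auto simp: algebra_simps)
  next
    show "continuous_on {0..t} ?h"
      using p s by (auto intro!: continuous_intros continuous_on_powr')
  qed (use t in auto)
  then show ?thesis using p by simp
qed (use p in auto)

text \<open>
  Young's inequality with exponents \<open>p\<close> and \<open>p / (p - 1)\<close>, with the weight \<open>c\<close> distributed so that
  the factor in front of \<open>s powr p\<close> can be made small.
\<close>

lemma young_powr:
  fixes p s t c :: real
  assumes p: "1 < p" "p \<le> 2" and st: "0 \<le> s" "0 \<le> t" and c: "0 < c"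
  shows "p * (t * s powr (p - 1)) \<le> c powr (p - 1) * t powr p + s powr p / c"
proof (cases "s = 0 \<or> t = 0")
  case False
  then have s: "0 < s" and t: "0 < t" using st by auto
  let ?a = "c powr (p - 1) * t powr p" and ?b = "s powr p / c"
  have ab: "0 < ?a" "0 < ?b" using s t c by auto
  have "?a powr (1 / p) * ?b powr (1 - 1 / p) = t * s powr (p - 1)"
  proof -
    have e: "p * (1 - 1 / p) = p - 1" "(p - 1) * (1 / p) = 1 - 1 / p" using p by (auto simp: field_simps)
    have "?a powr (1 / p) = c powr (1 - 1 / p) * t"
      using t c p e by (simp add: powr_mult powr_powr)
    moreover have "?b powr (1 - 1 / p) = s powr (p - 1) / c powr (1 - 1 / p)"
      using s c p e by (simp add: powr_divide powr_powr)
    ultimately show ?thesis using c by simp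
  qed
  with Youngs_inequality_0[of "1 / p" "1 - 1 / p" ?a ?b] p ab
  have "t * s powr (p - 1) \<le> 1 / p * ?a + (1 - 1 / p) * ?b" by simp
  then have "p * (t * s powr (p - 1)) \<le> p * (1 / p * ?a + (1 - 1 / p) * ?b)"
    using p by (intro mult_left_mono) auto
  also have "\<dots> = (p * (1 / p)) * ?a + (p * (1 - 1 / p)) * ?b"
    by (simp only: distrib_left mult.assoc)
  also have "p * (1 / p) = 1" using p by simp
  also have "p * (1 - 1 / p) = p - 1" using p by (simp add: field_simps)
  also have "1 * ?a + (p - 1) * ?b \<le> 1 * ?a + 1 * ?b"
    using p ab by (intro add_left_mono mult_right_mono) auto
  finally show ?thesis by simp
qed (use p c in auto)

context finite_atomic_filtration
begin

section \<open>Carleson packing along the filtration\<close>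

lemma diamond_child:
  assumes A: "A \<in> \<A> n"
  shows "diamond ch n A \<in> {B \<in> \<A> (Suc n). B \<subseteq> A}"
proof -
  have "A \<in> sets (F (Suc n))" by (rule atom_in_later_F[OF _ A]) simp
  from Union_atoms_within[OF this] atom_nonempty[OF A]
  have "set (ch n A) \<noteq> {}" unfolding set_ch[OF A] by blast
  then have "hd (ch n A) \<in> set (ch n A)" by (intro hd_in_set) auto
  then show ?thesis unfolding diamond_def set_ch[OF A] .
qed

lemma E_level_children:
  assumes A: "A \<in> \<A> n"
  shows "{B \<in> E_level \<A> ch (Suc n). B \<subseteq> A} = {B \<in> \<A> (Suc n). B \<subseteq> A} - {diamond ch n A}"
proof -
  have "B = diamond ch n A" if B: "B \<in> \<A> (Suc n)" "B \<subseteq> A" and C: "B \<in> C_level \<A> ch (Suc n)" for B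
  proof -
    from C obtain A' where A': "A' \<in> \<A> n" "B = diamond ch n A'" by auto
    then have "B \<subseteq> A'" using diamond_child by blast
    then have "A = A'" using atom_eq[OF A A'(1), of "rep B"] rep_in[OF B(1)] B(2) by blast
    with A' show ?thesis by simp
  qed
  with A show ?thesis unfolding E_level_def by auto
qed

lemma E_level_subset: "E_level \<A> ch n \<subseteq> \<A> n"
  unfolding E_level_def by blast

text \<open>
  A set that is an atom of several levels has itself as its only child between them, so it is the
  child removed at every level after its first. Sums over the collection \<open>\<E>\<close> therefore agree with
  sums over its levels.
\<close>

lemma E_level_disjoint:
  assumes "n < m" and In: "I \<in> E_level \<A> ch n" and Im: "I \<in> E_level \<A> ch m"
  shows False
proof -
  obtain k where m: "m = Suc k" and nk: "n \<le> k" using \<open>n < m\<close> by (cases m) auto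
  have I: "I \<in> \<A> n" "I \<in> \<A> (Suc k)" using In Im m E_level_subset by blast+
  have r: "rep I \<in> I" using rep_in I(1) .
  obtain A where A: "A \<in> \<A> k" "rep I \<in> A"
    using atom_cover[of "rep I" k] r atom_subset_space[OF I(1)] by blast
  have "A \<subseteq> I" by (rule atom_nested[OF nk I(1) A(1) r A(2)])
  moreover have "I \<subseteq> A" by (rule atom_nested[OF _ A(1) I(2) A(2) r]) simp
  ultimately have Ik: "I \<in> \<A> k" using A(1) by simp
  have d: "diamond ch k I \<in> \<A> (Suc k)" "diamond ch k I \<subseteq> I" using diamond_child[OF Ik] by auto
  have "rep (diamond ch k I) \<in> I" using rep_in[OF d(1)] d(2) by blast
  then have "diamond ch k I = I" using atom_eq[OF d(1) I(2) rep_in[OF d(1)]] by simp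
  then have "I \<in> C_level \<A> ch m" using Ik m by auto
  with Im show False unfolding E_level_def by blast
qed

lemma finite_E_level: "finite {J \<in> E_level \<A> ch m. J \<subseteq> I}"
  by (rule finite_subset[OF _ finite_atoms[of m]]) (auto simp: E_level_def)

text \<open>
  The Carleson condition in the form used below: a bound for finitely many levels at a time.
\<close>

lemma carleson_levels:
  assumes K: "carleson M (E_coll \<A> ch) = ennreal K" "0 \<le> K"
    and I: "I \<in> E_level \<A> ch n"
  shows "(\<Sum>m=n..N. \<Sum>J\<in>{J \<in> E_level \<A> ch m. J \<subseteq> I}. prob J) \<le> K * prob I"
proof -
  let ?E = "E_coll \<A> ch" and ?W = "\<Union>m\<in>{n..N}. {J \<in> E_level \<A> ch m. J \<subseteq> I}"
  have IA: "I \<in> \<A> n" using I E_level_subset by blast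
  have pI: "emeasure M I \<noteq> 0" "emeasure M I < top"
    using prob_atoms_pos[OF IA] by (auto simp: emeasure_eq_measure)
  have fin: "finite ?W" by (intro finite_UN_I finite_atLeastAtMost finite_E_level)
  have W: "?W \<subseteq> {J \<in> ?E. J \<subseteq> I}" by (auto simp: E_coll_def)
  have "(\<Sum>m=n..N. \<Sum>J\<in>{J \<in> E_level \<A> ch m. J \<subseteq> I}. prob J) = (\<Sum>J\<in>?W. prob J)"
  proof (rule sum.UNION_disjoint[symmetric])
    show "\<forall>i\<in>{n..N}. \<forall>j\<in>{n..N}. i \<noteq> j \<longrightarrow>
        {J \<in> E_level \<A> ch i. J \<subseteq> I} \<inter> {J \<in> E_level \<A> ch j. J \<subseteq> I} = {}"
      using E_level_disjoint by (metis (no_types, lifting) disjoint_iff linorder_neqE_nat mem_Collect_eq)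
  qed (auto simp: finite_E_level)
  then have "ennreal (\<Sum>m=n..N. \<Sum>J\<in>{J \<in> E_level \<A> ch m. J \<subseteq> I}. prob J) = (\<Sum>J\<in>?W. emeasure M J)"
    by (simp add: emeasure_eq_measure)
  also have "\<dots> = (\<Sum>\<^sub>\<infinity>J\<in>?W. emeasure M J)"
    using fin by simp
  also have "\<dots> \<le> (\<Sum>\<^sub>\<infinity>J\<in>{J \<in> ?E. J \<subseteq> I}. emeasure M J)"
    using W by (intro infsum_mono_neutral) (auto intro: nonneg_summable_on_complete)
  also have "\<dots> = (\<Sum>\<^sub>\<infinity>J\<in>{J \<in> ?E. J \<subseteq> I}. emeasure M J) / emeasure M I * emeasure M I"
    using pI by (simp add: ennreal_divide_times ennreal_divide_self)
  also have "\<dots> \<le> carleson M ?E * emeasure M I"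
    unfolding carleson_def using I by (intro mult_right_mono SUP_upper) (auto simp: E_coll_def)
  also have "\<dots> = ennreal (K * prob I)"
    using K by (simp add: emeasure_eq_measure ennreal_mult)
  finally show ?thesis using K(2) by (simp add: ennreal_le_iff)
qed

text \<open>
  The space itself belongs to \<open>\<E>\<close>; so \<open>K\<close> may be divided by.
\<close>

lemma carleson_ge_1:
  assumes K: "carleson M (E_coll \<A> ch) = ennreal K" "0 \<le> K"
  shows "1 \<le> K"
proof -
  have "space M \<in> E_level \<A> ch 0" by (simp add: E_level_def atoms_0)
  moreover have "{J \<in> E_level \<A> ch 0. J \<subseteq> space M} = {space M}" by (auto simp: E_level_def atoms_0)
  ultimately show ?thesis using carleson_levels[OF K, of "space M" 0 0] by (simp add: prob_space)
qed

lemma E_level_within_refine: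
  fixes g :: "'a set \<Rightarrow> real"
  assumes J: "J \<in> \<A> m" and l: "Suc m \<le> l"
  shows "(\<Sum>I\<in>{I \<in> E_level \<A> ch l. I \<subseteq> J}. g I) =
    (\<Sum>B\<in>{B \<in> \<A> (Suc m). B \<subseteq> J}. \<Sum>I\<in>{I \<in> E_level \<A> ch l. I \<subseteq> B}. g I)"
proof -
  let ?C = "{B \<in> \<A> (Suc m). B \<subseteq> J}"
  have "{I \<in> E_level \<A> ch l. I \<subseteq> J} = (\<Union>B\<in>?C. {I \<in> E_level \<A> ch l. I \<subseteq> B})"
  proof (intro equalityI subsetI)
    fix I assume "I \<in> {I \<in> E_level \<A> ch l. I \<subseteq> J}"
    then have I: "I \<in> E_level \<A> ch l" "I \<in> \<A> l" "I \<subseteq> J" using E_level_subset by auto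
    have "J \<in> sets (F (Suc m))" by (rule atom_in_later_F[OF _ J]) simp
    from Union_atoms_within[OF this] rep_in[OF I(2)] I(3)
    obtain B where B: "B \<in> ?C" "rep I \<in> B" by blast
    have "I \<subseteq> B" by (rule atom_nested[OF l _ I(2) B(2) rep_in[OF I(2)]]) (use B in simp)
    with B I show "I \<in> (\<Union>B\<in>?C. {I \<in> E_level \<A> ch l. I \<subseteq> B})" by blast
  qed auto
  moreover have "(\<Sum>I\<in>(\<Union>B\<in>?C. {I \<in> E_level \<A> ch l. I \<subseteq> B}). g I) =
      (\<Sum>B\<in>?C. \<Sum>I\<in>{I \<in> E_level \<A> ch l. I \<subseteq> B}. g I)"
  proof (rule sum.UNION_disjoint[OF finite_subatoms])
    show "\<forall>i\<in>?C. \<forall>j\<in>?C. i \<noteq> j \<longrightarrow> {I \<in> E_level \<A> ch l. I \<subseteq> i} \<inter> {I \<in> E_level \<A> ch l. I \<subseteq> j} = {}"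
      using rep_in E_level_subset[of l] atom_eq[of _ "Suc m"] by blast
  qed (auto simp: finite_E_level)
  ultimately show ?thesis by simp
qed

text \<open>
  The packing condition extends from members of \<open>\<E>\<close> to all atoms, provided only strictly deeper
  levels are counted. By induction on the number of levels it suffices to treat each child: a child
  in \<open>\<E>\<close> is covered by the Carleson condition, and a child outside \<open>\<E>\<close> contributes nothing at its
  own level, so the induction hypothesis applies to it.
\<close>

lemma carleson_below_atom:
  assumes K: "carleson M (E_coll \<A> ch) = ennreal K" "0 \<le> K"
    and J: "J \<in> \<A> m"
  shows "(\<Sum>l=Suc m..m+k. \<Sum>I\<in>{I \<in> E_level \<A> ch l. I \<subseteq> J}. prob I) \<le> K * prob J"
  using J
proof (induction k arbitrary: m J)
  case 0
  then show ?case using K(2) by simp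
next
  case (Suc k)
  let ?C = "{B \<in> \<A> (Suc m). B \<subseteq> J}"
  let ?s = "\<lambda>l B. \<Sum>I\<in>{I \<in> E_level \<A> ch l. I \<subseteq> B}. prob I"
  have "(\<Sum>l=Suc m..m+Suc k. ?s l J) = (\<Sum>l=Suc m..m+Suc k. \<Sum>B\<in>?C. ?s l B)"
    by (intro sum.cong refl E_level_within_refine[OF Suc.prems]) auto
  also have "\<dots> = (\<Sum>B\<in>?C. \<Sum>l=Suc m..m+Suc k. ?s l B)" by (rule sum.swap)
  also have "\<dots> \<le> (\<Sum>B\<in>?C. K * prob B)"
  proof (intro sum_mono)
    fix B assume "B \<in> ?C"
    then have B: "B \<in> \<A> (Suc m)" by simp
    show "(\<Sum>l=Suc m..m+Suc k. ?s l B) \<le> K * prob B"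
    proof (cases "B \<in> E_level \<A> ch (Suc m)")
      case True
      then show ?thesis by (rule carleson_levels[OF K])
    next
      case False
      have "I = B" if "I \<in> \<A> (Suc m)" "I \<subseteq> B" for I
        using atom_eq[OF that(1) B rep_in[OF that(1)]] rep_in[OF that(1)] that(2) by blast
      with False have "{I \<in> E_level \<A> ch (Suc m). I \<subseteq> B} = {}"
        using E_level_subset by blast
      then have z: "?s (Suc m) B = 0" by (simp only: sum.empty)
      have "(\<Sum>l=Suc m..m+Suc k. ?s l B) = ?s (Suc m) B + (\<Sum>l=Suc (Suc m)..Suc m+k. ?s l B)"
        by (subst sum.atLeast_Suc_atMost) simp_all
      also have "\<dots> \<le> K * prob B" using Suc.IH[OF B] z by simp
      finally show ?thesis .
    qed
  qed
  also have "\<dots> = K * (\<Sum>B\<in>?C. prob B)" by (simp add: sum_distrib_left)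
  also have "(\<Sum>B\<in>?C. prob B) = prob J"
    by (rule prob_atoms_within[OF atom_in_later_F[OF _ Suc.prems]]) simp
  finally show ?case .
qed

lemma indicator_Union_E_rep:
  assumes B: "B \<in> \<A> l"
  shows "indicat_real (\<Union>(E_level \<A> ch l)) (rep B) = (if B \<in> E_level \<A> ch l then 1 else 0)"
proof -
  have "rep B \<in> \<Union>(E_level \<A> ch l) \<longleftrightarrow> B \<in> E_level \<A> ch l"
    using atom_eq[OF B _ rep_in[OF B]] rep_in[OF B] E_level_subset by blast
  then show ?thesis by (simp add: indicator_def)
qed

lemma Union_E_level_in_F: "\<Union>(E_level \<A> ch l) \<in> sets (F l)"
  by (intro sets.finite_Union finite_subset[OF E_level_subset finite_atoms])
     (use E_level_subset atom_in_F in blast)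

lemma integral_Union_E_level:
  fixes w :: "'a \<Rightarrow> real"
  assumes "m \<le> l" and w: "level_const (\<A> m) w"
  shows "(\<integral>x. indicator (\<Union>(E_level \<A> ch l)) x * w x \<partial>M) =
    (\<Sum>J\<in>\<A> m. w (rep J) * (\<Sum>I\<in>{I \<in> E_level \<A> ch l. I \<subseteq> J}. prob I))"
proof -
  let ?E = "E_level \<A> ch l"
  have "(\<integral>x. indicator (\<Union>?E) x * w x \<partial>M) = (\<Sum>B\<in>\<A> l. prob B * (indicator (\<Union>?E) (rep B) * w (rep B)))"
    by (intro level_const_integral level_const_comp2[where h="(*)"] level_const_indicator
        Union_E_level_in_F level_const_mono[OF assms])
  also have "\<dots> = (\<Sum>J\<in>\<A> m. \<Sum>B\<in>{B \<in> \<A> l. B \<subseteq> J}. prob B * (indicator (\<Union>?E) (rep B) * w (rep B)))"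
    by (rule sum_atoms_refine[OF assms(1)])
  also have "\<dots> = (\<Sum>J\<in>\<A> m. w (rep J) * (\<Sum>I\<in>{I \<in> ?E. I \<subseteq> J}. prob I))"
  proof (intro sum.cong refl)
    fix J assume J: "J \<in> \<A> m"
    have "(\<Sum>B\<in>{B \<in> \<A> l. B \<subseteq> J}. prob B * (indicator (\<Union>?E) (rep B) * w (rep B))) =
        (\<Sum>B\<in>{B \<in> \<A> l. B \<subseteq> J}. if B \<in> ?E then w (rep J) * prob B else 0)"
      by (intro sum.cong) (auto simp: indicator_Union_E_rep level_const_rep_sub[OF w J])
    also have "\<dots> = (\<Sum>B\<in>{B \<in> {B \<in> \<A> l. B \<subseteq> J}. B \<in> ?E}. w (rep J) * prob B)"
      by (rule sum.inter_filter[symmetric, OF finite_subatoms])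
    also have "{B \<in> {B \<in> \<A> l. B \<subseteq> J}. B \<in> ?E} = {I \<in> ?E. I \<subseteq> J}" using E_level_subset by blast
    finally show "(\<Sum>B\<in>{B \<in> \<A> l. B \<subseteq> J}. prob B * (indicator (\<Union>?E) (rep B) * w (rep B))) =
        w (rep J) * (\<Sum>I\<in>{I \<in> ?E. I \<subseteq> J}. prob I)" by (simp add: sum_distrib_left)
  qed
  finally show ?thesis .
qed

text \<open>
  A Carleson embedding for the increasing process with increments \<open>\<delta>\<^sub>j\<close>. After interchanging the
  sums, each increment is integrated against the number of later levels of \<open>\<E>\<close> that cover a point,
  and the packing condition bounds the mean of this number on every atom of level \<open>j\<close> by \<open>K\<close>.
\<close>

lemma carleson_increasing_process:
  fixes \<delta> :: "nat \<Rightarrow> 'a \<Rightarrow> real"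
  assumes K: "carleson M (E_coll \<A> ch) = ennreal K" "0 \<le> K"
    and lc: "\<And>j. level_const (\<A> j) (\<delta> j)" and nn: "\<And>j x. 0 \<le> \<delta> j x"
  shows "(\<Sum>i\<le>N. \<integral>x. indicator (\<Union>(E_level \<A> ch i)) x * (\<Sum>j<i. \<delta> j x) \<partial>M) \<le>
    K * (\<integral>x. (\<Sum>j<N. \<delta> j x) \<partial>M)"
proof -
  let ?U = "\<lambda>i. \<Union>(E_level \<A> ch i)"
  have int: "integrable M (\<lambda>x. indicator (?U i) x * \<delta> j x)" if "j < i" for i j
    by (rule level_const_integrable[of i])
       (use that in \<open>intro level_const_comp2[where h="(*)"] level_const_indicator
         Union_E_level_in_F level_const_mono[OF _ lc], simp\<close>)
  have "(\<Sum>i\<le>N. \<integral>x. indicator (?U i) x * (\<Sum>j<i. \<delta> j x) \<partial>M) =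
      (\<Sum>i\<le>N. \<Sum>j<i. \<integral>x. indicator (?U i) x * \<delta> j x \<partial>M)"
    unfolding sum_distrib_left by (intro sum.cong refl Bochner_Integration.integral_sum int) auto
  also have "\<dots> = (\<Sum>j<N. \<Sum>i=Suc j..N. \<integral>x. indicator (?U i) x * \<delta> j x \<partial>M)"
    by (rule sum.nested_swap')
  also have "\<dots> \<le> (\<Sum>j<N. K * (\<integral>x. \<delta> j x \<partial>M))"
  proof (intro sum_mono)
    fix j assume "j \<in> {..<N}"
    then have jN: "j + (N - j) = N" by simp
    have "(\<Sum>i=Suc j..N. \<integral>x. indicator (?U i) x * \<delta> j x \<partial>M) =
        (\<Sum>i=Suc j..N. \<Sum>J\<in>\<A> j. \<delta> j (rep J) * (\<Sum>I\<in>{I \<in> E_level \<A> ch i. I \<subseteq> J}. prob I))"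
      by (intro sum.cong refl integral_Union_E_level lc) auto
    also have "\<dots> = (\<Sum>J\<in>\<A> j. \<delta> j (rep J) * (\<Sum>i=Suc j..N. \<Sum>I\<in>{I \<in> E_level \<A> ch i. I \<subseteq> J}. prob I))"
      by (subst sum.swap) (simp add: sum_distrib_left)
    also have "\<dots> \<le> (\<Sum>J\<in>\<A> j. \<delta> j (rep J) * (K * prob J))"
      using carleson_below_atom[OF K, of _ j "N - j"] jN nn
      by (intro sum_mono mult_left_mono) auto
    also have "\<dots> = K * (\<integral>x. \<delta> j x \<partial>M)"
      by (simp add: level_const_integral[OF lc] sum_distrib_left mult_ac)
    finally show "(\<Sum>i=Suc j..N. \<integral>x. indicator (?U i) x * \<delta> j x \<partial>M) \<le> K * (\<integral>x. \<delta> j x \<partial>M)" .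
  qed
  also have "\<dots> = K * (\<integral>x. (\<Sum>j<N. \<delta> j x) \<partial>M)"
    by (simp add: Bochner_Integration.integral_sum level_const_integrable[OF lc] sum_distrib_left)
  finally show ?thesis .
qed

section \<open>The moment estimate for martingales\<close>

text \<open>
  Of the children of an atom \<open>A\<close> only \<open>A\<^sup>\<diamond>\<close> is outside \<open>\<E>\<close>. As \<open>d\<close> has mean zero on \<open>A\<close>, its
  integral over \<open>A\<^sup>\<diamond>\<close> is minus the sum of its integrals over the other children, and \<open>w\<close> is constant
  on \<open>A\<close>.
\<close>

lemma martingale_difference_concentrates:
  fixes d :: "'a \<Rightarrow> 'b::real_normed_vector" and w :: "'a \<Rightarrow> real"
  assumes d: "level_const (\<A> (Suc n)) d"
    and mart: "\<And>A. A \<in> \<A> n \<Longrightarrow> (\<Sum>B\<in>{B \<in> \<A> (Suc n). B \<subseteq> A}. prob B *\<^sub>R d (rep B)) = 0"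
    and w: "level_const (\<A> n) w" "\<And>x. 0 \<le> w x"
  shows "(\<integral>x. norm (d x) * w x \<partial>M) \<le>
    2 * (\<integral>x. indicator (\<Union>(E_level \<A> ch (Suc n))) x * (norm (d x) * w x) \<partial>M)"
proof -
  let ?E = "E_level \<A> ch (Suc n)" and ?C = "\<lambda>A. {B \<in> \<A> (Suc n). B \<subseteq> A}"
  have lc: "level_const (\<A> (Suc n)) (\<lambda>x. norm (d x) * w x)"
    by (intro level_const_comp2[where h="\<lambda>u v. norm u * v"] d level_const_mono[OF _ w(1)]) simp
  have "(\<integral>x. norm (d x) * w x \<partial>M) = (\<Sum>A\<in>\<A> n. \<Sum>B\<in>?C A. prob B * (norm (d (rep B)) * w (rep B)))"
    unfolding level_const_integral[OF lc] by (rule sum_atoms_refine) simp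
  also have "\<dots> \<le> (\<Sum>A\<in>\<A> n. 2 * (\<Sum>B\<in>?C A. prob B * (indicator (\<Union>?E) (rep B) * (norm (d (rep B)) * w (rep B)))))"
  proof (intro sum_mono)
    fix A assume A: "A \<in> \<A> n"
    let ?D = "diamond ch n A"
    have D: "?D \<in> ?C A" by (rule diamond_child[OF A])
    have wr: "w (rep B) = w (rep A)" if "B \<in> ?C A" for B
      using level_const_rep_sub[OF w(1) A] that by blast
    have E: "B \<in> ?E \<longleftrightarrow> B \<noteq> ?D" if "B \<in> ?C A" for B
      using E_level_children[OF A] that by blast
    have eq: "prob ?D *\<^sub>R d (rep ?D) = - (\<Sum>B\<in>?C A - {?D}. prob B *\<^sub>R d (rep B))"
      using mart[OF A] sum.remove[OF finite_subatoms D, of "\<lambda>B. prob B *\<^sub>R d (rep B)"]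
      by (simp add: eq_neg_iff_add_eq_0)
    have "prob ?D * norm (d (rep ?D)) = norm (prob ?D *\<^sub>R d (rep ?D))" by simp
    also have "\<dots> = norm (\<Sum>B\<in>?C A - {?D}. prob B *\<^sub>R d (rep B))"
      unfolding eq by (rule norm_minus_cancel)
    also have "\<dots> \<le> (\<Sum>B\<in>?C A - {?D}. prob B * norm (d (rep B)))"
      by (rule order_trans[OF norm_sum]) simp
    finally have le: "prob ?D * norm (d (rep ?D)) \<le> (\<Sum>B\<in>?C A - {?D}. prob B * norm (d (rep B)))" .
    have "(\<Sum>B\<in>?C A. prob B * (norm (d (rep B)) * w (rep B))) =
        (\<Sum>B\<in>?C A. prob B * norm (d (rep B))) * w (rep A)"
      unfolding sum_distrib_right by (intro sum.cong) (auto simp: wr)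
    also have "(\<Sum>B\<in>?C A. prob B * norm (d (rep B))) =
        prob ?D * norm (d (rep ?D)) + (\<Sum>B\<in>?C A - {?D}. prob B * norm (d (rep B)))"
      by (rule sum.remove[OF finite_subatoms D])
    also have "(prob ?D * norm (d (rep ?D)) + (\<Sum>B\<in>?C A - {?D}. prob B * norm (d (rep B)))) * w (rep A)
        \<le> (2 * (\<Sum>B\<in>?C A - {?D}. prob B * norm (d (rep B)))) * w (rep A)"
      using le w(2) by (intro mult_right_mono) auto
    also have "\<dots> = 2 * ((\<Sum>B\<in>?C A - {?D}. prob B * norm (d (rep B))) * w (rep A))"
      by (rule mult.assoc)
    also have "(\<Sum>B\<in>?C A - {?D}. prob B * norm (d (rep B))) * w (rep A) =
        (\<Sum>B\<in>?C A. prob B * (indicator (\<Union>?E) (rep B) * (norm (d (rep B)) * w (rep B))))"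
    proof -
      have "(\<Sum>B\<in>?C A. prob B * (indicator (\<Union>?E) (rep B) * (norm (d (rep B)) * w (rep B)))) =
          (\<Sum>B\<in>?C A - {?D}. prob B * norm (d (rep B)) * w (rep A))"
      proof (rule sum.mono_neutral_cong_right)
        show "\<forall>B\<in>?C A - (?C A - {?D}). prob B * (indicator (\<Union>?E) (rep B) * (norm (d (rep B)) * w (rep B))) = 0"
          using E by (auto simp: indicator_Union_E_rep)
        show "prob B * (indicator (\<Union>?E) (rep B) * (norm (d (rep B)) * w (rep B))) =
            prob B * norm (d (rep B)) * w (rep A)" if "B \<in> ?C A - {?D}" for B
          using E[of B] wr[of B] that by (simp add: indicator_Union_E_rep)
      qed (use finite_subatoms in auto)
      then show ?thesis by (simp add: sum_distrib_right)
    qed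
    finally show "(\<Sum>B\<in>?C A. prob B * (norm (d (rep B)) * w (rep B))) \<le>
        2 * (\<Sum>B\<in>?C A. prob B * (indicator (\<Union>?E) (rep B) * (norm (d (rep B)) * w (rep B))))" .
  qed
  also have "\<dots> = 2 * (\<Sum>B\<in>\<A> (Suc n). prob B * (indicator (\<Union>?E) (rep B) * (norm (d (rep B)) * w (rep B))))"
    by (subst sum_atoms_refine[of n "Suc n"]) (simp_all add: sum_distrib_left)
  also have "\<dots> = 2 * (\<integral>x. indicator (\<Union>?E) x * (norm (d x) * w x) \<partial>M)"
    by (subst level_const_integral[of "Suc n"])
       (auto intro: level_const_comp2[where h="(*)", OF level_const_indicator[OF Union_E_level_in_F] lc])
  finally show ?thesis .
qed

text \<open>
  The heart of the proof: a bound for the sum of the norms, in which the Banach space enters only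
  through the triangle inequality.
\<close>

lemma integral_powr_sum_norm_le:
  fixes d :: "nat \<Rightarrow> 'a \<Rightarrow> 'b::real_normed_vector"
  assumes p: "1 < p" "p \<le> 2"
    and K: "carleson M (E_coll \<A> ch) = ennreal K" "0 \<le> K"
    and d: "\<And>n. level_const (\<A> n) (d n)"
    and mart: "\<And>n A. A \<in> \<A> n \<Longrightarrow> (\<Sum>B\<in>{B \<in> \<A> (Suc n). B \<subseteq> A}. prob B *\<^sub>R d (Suc n) (rep B)) = 0"
  shows "(\<integral>x. (\<Sum>k\<le>N. norm (d k x)) powr p \<partial>M) \<le>
    6 * (4 * K + 1) powr (p - 1) * (\<Sum>k\<le>N. \<integral>x. norm (d k x) powr p \<partial>M)"
proof -
  define s where "s n x = (\<Sum>k<n. norm (d k x))" for n x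
  define D where "D n = (\<integral>x. norm (d n x) powr p \<partial>M)" for n
  define Y where "Y n = (\<integral>x. s n x powr p \<partial>M)" for n
  define V where "V n = (\<integral>x. indicator (\<Union>(E_level \<A> ch n)) x * s n x powr p \<partial>M)" for n
  \<comment> \<open>with this weight the Carleson bound below becomes half of the moment being estimated\<close>
  define c where "c = 4 * K"
  have K1: "1 \<le> K" by (rule carleson_ge_1[OF K])
  then have c: "0 < c" by (simp add: c_def)
  have s_nn: "0 \<le> s n x" for n x unfolding s_def by (intro sum_nonneg) auto
  have s_lc: "level_const (\<A> m) (s n)" if "n \<le> Suc m" for m n
    unfolding s_def using that
    by (intro level_const_sum level_const_comp[where h=norm] level_const_mono[OF _ d]) auto
  have s_Suc: "s (Suc n) x = s n x + norm (d n x)" for n x by (simp add: s_def)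
  have s_0: "s 0 x = 0" for x by (simp add: s_def)
  note U_lc = level_const_indicator[OF Union_E_level_in_F]
  have D_nn: "0 \<le> D n" for n unfolding D_def by (intro integral_nonneg_AE) auto
  have lcs: "level_const (\<A> n) (\<lambda>x. s n x powr q)" "level_const (\<A> n) (\<lambda>x. s (Suc n) x powr q)"
    "level_const (\<A> n) (\<lambda>x. norm (d n x) powr q)"
    "level_const (\<A> n) (\<lambda>x. norm (d n x) * s n x powr q)" for n q
    by (intro level_const_comp[where h="\<lambda>u. u powr q"] s_lc level_const_comp[where h="\<lambda>u. norm u powr q"]
        level_const_comp2[where h="\<lambda>u v. norm u * v powr q"] d; simp)+
  note ints = lcs[THEN level_const_integrable] level_const_comp2[where h="(*)", OF U_lc lcs(1), THEN level_const_integrable]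
    level_const_comp2[where h="(*)", OF U_lc lcs(3), THEN level_const_integrable]
    level_const_comp2[where h="(*)", OF U_lc lcs(4), THEN level_const_integrable]
  have cross: "p * (\<integral>x. norm (d n x) * s n x powr (p - 1) \<partial>M) \<le> 2 * c powr (p - 1) * D n + 2 / c * V n" for n
  proof -
    let ?i = "indicator (\<Union>(E_level \<A> ch n)) :: 'a \<Rightarrow> real"
    \<comment> \<open>at level 0 there is no parent atom to average over, but then s vanishes\<close>
    have "(\<integral>x. norm (d n x) * s n x powr (p - 1) \<partial>M) \<le>
        2 * (\<integral>x. ?i x * (norm (d n x) * s n x powr (p - 1)) \<partial>M)"
    proof (cases n)
      case 0
      then show ?thesis by (simp add: s_0)
    next
      case (Suc m)
      show ?thesis unfolding Suc
        by (rule martingale_difference_concentrates)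
           (auto intro: d mart level_const_comp[where h="\<lambda>u. u powr (p - 1)", OF s_lc])
    qed
    then have "p * (\<integral>x. norm (d n x) * s n x powr (p - 1) \<partial>M) \<le>
        p * (2 * (\<integral>x. ?i x * (norm (d n x) * s n x powr (p - 1)) \<partial>M))"
      using p by (intro mult_left_mono) auto
    also have "\<dots> = 2 * (\<integral>x. p * (?i x * (norm (d n x) * s n x powr (p - 1))) \<partial>M)"
      by simp
    also have "(\<integral>x. p * (?i x * (norm (d n x) * s n x powr (p - 1))) \<partial>M) \<le>
        (\<integral>x. c powr (p - 1) * norm (d n x) powr p + (1 / c) * (?i x * s n x powr p) \<partial>M)"
    proof (rule integral_mono)
      fix x
      show "p * (?i x * (norm (d n x) * s n x powr (p - 1))) \<le>
          c powr (p - 1) * norm (d n x) powr p + (1 / c) * (?i x * s n x powr p)"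
        using young_powr[OF p s_nn[of n x] norm_ge_zero[of "d n x"] c] by (auto simp: indicator_def)
    qed (intro Bochner_Integration.integrable_add integrable_mult_right ints)+
    also have "\<dots> = c powr (p - 1) * D n + (1 / c) * V n"
      unfolding D_def V_def by (simp add: ints)
    finally show ?thesis by (simp add: algebra_simps)
  qed
  have step: "Y (Suc n) \<le> Y n + ((1 + 2 * c powr (p - 1)) * D n + 2 / c * V n)" for n
  proof -
    have "Y (Suc n) \<le> (\<integral>x. s n x powr p + p * (norm (d n x) * s n x powr (p - 1)) + norm (d n x) powr p \<partial>M)"
      unfolding Y_def s_Suc
      by (rule integral_mono)
         (intro Bochner_Integration.integrable_add integrable_mult_right ints ints(2)[unfolded s_Suc]
            powr_add_le_tangent p s_nn norm_ge_zero)+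
    also have "\<dots> = Y n + p * (\<integral>x. norm (d n x) * s n x powr (p - 1) \<partial>M) + D n"
      unfolding Y_def D_def by (simp add: ints)
    finally show ?thesis using cross[of n] by (simp add: algebra_simps)
  qed
  have Y_le: "Y (Suc N) \<le> (1 + 2 * c powr (p - 1)) * (\<Sum>n\<le>N. D n) + 2 / c * (\<Sum>n\<le>N. V n)" for N
  proof (induction N)
    case 0
    have "Y 0 = 0" using p by (simp add: Y_def s_0)
    then show ?case using step[of 0] by simp
  next
    case (Suc N)
    then show ?case using step[of "Suc N"] by (simp add: algebra_simps)
  qed
  \<comment> \<open>\<open>s\<close> sums strictly smaller indices, so \<open>s j\<close> belongs to level \<open>j - 1\<close>, and \<open>\<delta> j\<close> to level \<open>j\<close>\<close>
  define \<delta> where "\<delta> j x = s (Suc j) x powr p - s j x powr p" for j x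
  have tele: "(\<Sum>j<i. \<delta> j x) = s i x powr p" for i x
    unfolding \<delta>_def using sum_lessThan_telescope[of "\<lambda>j. s j x powr p" i] p by (simp add: s_0)
  have "(\<Sum>n\<le>N. V n) \<le> K * Y N"
    unfolding V_def Y_def tele[symmetric]
  proof (rule carleson_increasing_process[OF K])
    show "level_const (\<A> j) (\<delta> j)" for j
      unfolding \<delta>_def by (rule level_const_comp2[where h="(-)", OF lcs(2,1)])
    show "0 \<le> \<delta> j x" for j x
      unfolding \<delta>_def using p by (simp add: s_Suc s_nn powr_mono2)
  qed
  also have "\<dots> \<le> K * Y (Suc N)"
    unfolding Y_def using K(2) p
    by (intro mult_left_mono integral_mono ints ints(2)[of "N"] powr_mono2) (auto simp: s_Suc s_nn)
  finally have "2 / c * (\<Sum>n\<le>N. V n) \<le> 2 / c * (K * Y (Suc N))"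
    using c by (intro mult_left_mono) auto
  also have "\<dots> = Y (Suc N) / 2" using K1 by (simp add: c_def)
  finally have "Y (Suc N) \<le> (1 + 2 * c powr (p - 1)) * (\<Sum>n\<le>N. D n) + Y (Suc N) / 2"
    using Y_le[of N] by simp
  then have "Y (Suc N) \<le> (2 + 4 * c powr (p - 1)) * (\<Sum>n\<le>N. D n)" by (simp add: algebra_simps)
  also have "\<dots> \<le> 6 * (4 * K + 1) powr (p - 1) * (\<Sum>n\<le>N. D n)"
  proof (intro mult_right_mono sum_nonneg D_nn)
    have "c powr (p - 1) \<le> (4 * K + 1) powr (p - 1)"
      using c p by (intro powr_mono2) (auto simp: c_def)
    moreover have "1 \<le> (4 * K + 1) powr (p - 1)"
      using K1 p by (intro ge_one_powr_ge_zero) auto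
    ultimately show "2 + 4 * c powr (p - 1) \<le> 6 * (4 * K + 1) powr (p - 1)" by simp
  qed
  finally show ?thesis unfolding Y_def D_def s_def lessThan_Suc_atMost .
qed

end

section \<open>Norms and constants in the extended half-line\<close>

lemma epowr_ennreal: "0 \<le> r \<Longrightarrow> epowr (ennreal r) a = ennreal (r powr a)"
  by (simp add: epowr_def)

lemma epowr_mono:
  assumes "x \<le> y" "0 \<le> a"
  shows "epowr x a \<le> epowr y a"
proof (cases y)
  case (real s)
  then obtain r where "x = ennreal r" "0 \<le> r" "r \<le> s"
    using assms(1) by (cases x) (auto simp: top_unique)
  then show ?thesis using real assms(2) by (simp add: epowr_ennreal powr_mono2 ennreal_leI)
qed (simp add: epowr_def)

lemma Lp_norm_epowr:
  assumes "0 < p"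
  shows "epowr (Lp_norm p M f) p = (\<integral>\<^sup>+x. ennreal (norm (f x) powr p) \<partial>M)"
  unfolding Lp_norm_def
proof (cases "\<integral>\<^sup>+x. ennreal (norm (f x) powr p) \<partial>M")
  case (real r)
  then show "epowr (epowr (\<integral>\<^sup>+x. ennreal (norm (f x) powr p) \<partial>M) (1 / p)) p =
      (\<integral>\<^sup>+x. ennreal (norm (f x) powr p) \<partial>M)"
    using assms by (simp add: epowr_ennreal powr_powr)
qed (simp add: epowr_def)

text \<open>
  From \<open>p > 1\<close> one gets \<open>2\<^sup>-\<^sup>1\<^sup>/\<^sup>p \<ge> 1 / 2\<close> and \<open>2\<^sup>2\<^sup>-\<^sup>1\<^sup>/\<^sup>p \<ge> 2\<close>, so that the numerical
  factor of the constant is at least \<open>(1 + 2) 2\<close>. The factor with the martingale type constant is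
  the \<open>p\<close>-th root of a number that is at least \<open>1\<close>.
\<close>

lemma T_const_ge:
  assumes p: "1 < p" and K: "0 \<le> K"
  shows "ennreal (6 * (4 * K + 1) powr (1 - 1 / p)) \<le> T_const p (ennreal K)"
proof -
  let ?u = "(2::real) powr (- 1 / p)"
  have "2 powr (- 1) \<le> ?u" using p by (intro powr_mono) (auto simp: field_simps)
  then have u: "1 / 2 \<le> ?u" by (simp add: powr_minus)
  have u1: "?u < 1" using p by (intro powr_less_one) (auto simp: field_simps)
  have "2 \<le> 1 / (1 - ?u)" using u u1 by (simp add: field_simps)
  moreover have "(2::real) powr 1 \<le> 2 powr (2 - 1 / p)"
    using p by (intro powr_mono) (auto simp: field_simps)
  ultimately have "3 * 2 \<le> (1 + 1 / (1 - ?u)) * 2 powr (2 - 1 / p)"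
    by (intro mult_mono) auto
  then have a: "ennreal 6 \<le> ennreal ((1 + 1 / (1 - ?u)) * 2 powr (2 - 1 / p))"
    by (intro ennreal_leI) simp
  have "epowr 1 (1 / p) \<le> epowr (1 + epowr (MT_real p) p) (1 / p)"
    using p by (intro epowr_mono) auto
  moreover have "epowr 1 (1 / p) = 1" using epowr_ennreal[of 1 "1 / p"] by simp
  ultimately have b: "1 \<le> epowr (1 + epowr (MT_real p) p) (1 / p)" by simp
  have "4 * ennreal K + 1 = ennreal (4 * K + 1)"
    using K by (simp add: ennreal_plus ennreal_mult)
  then have c: "epowr (4 * ennreal K + 1) (1 - 1 / p) = ennreal ((4 * K + 1) powr (1 - 1 / p))"
    using K epowr_ennreal[of "4 * K + 1"] by (simp only:)
  have "ennreal (6 * (4 * K + 1) powr (1 - 1 / p)) = ennreal 6 * 1 * ennreal ((4 * K + 1) powr (1 - 1 / p))"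
    by (simp add: ennreal_mult)
  also have "\<dots> \<le> T_const p (ennreal K)"
    unfolding T_const_def c by (intro mult_mono a b) auto
  finally show ?thesis .
qed

section \<open>Passage to the limit\<close>

context finite_atomic_filtration
begin

lemma nn_integral_cond_exp_powr_le:
  fixes f :: "'a \<Rightarrow> 'b::banach"
  assumes p: "1 < p" "p \<le> 2"
    and K: "carleson M (E_coll \<A> ch) = ennreal K" "0 \<le> K"
    and f: "strongly_measurable M f" "(\<integral>\<^sup>+x. ennreal (norm (f x)) \<partial>M) < \<infinity>"
  shows "(\<integral>\<^sup>+x. ennreal (norm (cond_exp M (F N) f x) powr p) \<partial>M) \<le>
    ennreal (6 * (4 * K + 1) powr (p - 1)) *
      ((\<integral>\<^sup>+x. ennreal (norm (cond_exp M (F 0) f x) powr p) \<partial>M) +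
       (\<Sum>n<N. \<integral>\<^sup>+x. ennreal (norm (cond_exp M (F (Suc n)) f x - cond_exp M (F n) f x) powr p) \<partial>M))"
proof -
  define d where "d n x = (case n of 0 \<Rightarrow> cond_exp M (F 0) f x
    | Suc m \<Rightarrow> cond_exp M (F (Suc m)) f x - cond_exp M (F m) f x)" for n x
  have d0: "d 0 x = cond_exp M (F 0) f x" and dS: "d (Suc n) x = cond_exp M (F (Suc n)) f x - cond_exp M (F n) f x" for n x
    by (simp_all add: d_def)
  have d: "level_const (\<A> n) (d n)" for n
  proof (cases n)
    case 0
    then show ?thesis using cond_exp_level_const[OF f, of 0] by (simp add: d0[abs_def])
  next
    case (Suc m)
    have "level_const (\<A> (Suc m)) (d (Suc m))"
      unfolding dS[abs_def]
      by (intro level_const_comp2[where h="(-)"] cond_exp_level_const f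
          level_const_mono[OF _ cond_exp_level_const[OF f]]) simp
    then show ?thesis by (simp add: Suc)
  qed
  have mart: "(\<Sum>B\<in>{B \<in> \<A> (Suc n). B \<subseteq> A}. prob B *\<^sub>R d (Suc n) (rep B)) = 0" if "A \<in> \<A> n" for n A
    unfolding dS by (rule cond_exp_martingale[OF f that])
  have sum_d: "cond_exp M (F N) f x = (\<Sum>k\<le>N. d k x)" for x
    by (induction N) (simp_all add: d0 dS)
  have lc: "level_const (\<A> N) (\<lambda>x. (\<Sum>k\<le>N. norm (d k x)) powr p)"
    by (intro level_const_comp[where h="\<lambda>u. u powr p"] level_const_sum level_const_comp[where h=norm]
        level_const_mono[OF _ d]) simp
  have lcd: "level_const (\<A> n) (\<lambda>x. norm (d n x) powr p)" for n
    by (intro level_const_comp[where h="\<lambda>u. norm u powr p"] d)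
  have Dn: "(\<integral>\<^sup>+x. ennreal (norm (d n x) powr p) \<partial>M) = ennreal (\<integral>x. norm (d n x) powr p \<partial>M)" for n
    by (intro nn_integral_eq_integral level_const_integrable[OF lcd]) auto
  have "(\<integral>\<^sup>+x. ennreal (norm (cond_exp M (F N) f x) powr p) \<partial>M) \<le>
      (\<integral>\<^sup>+x. ennreal ((\<Sum>k\<le>N. norm (d k x)) powr p) \<partial>M)"
    unfolding sum_d using p by (intro nn_integral_mono ennreal_leI powr_mono2 norm_sum) auto
  also have "\<dots> = ennreal (\<integral>x. (\<Sum>k\<le>N. norm (d k x)) powr p \<partial>M)"
    by (intro nn_integral_eq_integral level_const_integrable[OF lc]) auto
  also have "\<dots> \<le> ennreal (6 * (4 * K + 1) powr (p - 1) * (\<Sum>k\<le>N. \<integral>x. norm (d k x) powr p \<partial>M))"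
    by (intro ennreal_leI integral_powr_sum_norm_le p K d mart)
  also have "\<dots> = ennreal (6 * (4 * K + 1) powr (p - 1)) * (\<Sum>k\<le>N. \<integral>\<^sup>+x. ennreal (norm (d k x) powr p) \<partial>M)"
    by (simp add: Dn ennreal_mult' sum_nonneg)
  also have "(\<Sum>k\<le>N. \<integral>\<^sup>+x. ennreal (norm (d k x) powr p) \<partial>M) =
      (\<integral>\<^sup>+x. ennreal (norm (d 0 x) powr p) \<partial>M) + (\<Sum>n<N. \<integral>\<^sup>+x. ennreal (norm (d (Suc n) x) powr p) \<partial>M)"
    by (simp add: sum.atMost_shift)
  finally show ?thesis unfolding d0 dS .
qed

text \<open>
  Fatou's lemma along a subsequence on which the conditional expectations converge almost everywhere.
\<close>

lemma nn_integral_powr_le_of_cond_exp_bound: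
  fixes f :: "'a \<Rightarrow> 'b::banach"
  assumes f: "strongly_measurable M f" "(\<integral>\<^sup>+x. ennreal (norm (f x)) \<partial>M) < \<infinity>" and p: "0 < p"
    and bound: "\<And>n. (\<integral>\<^sup>+x. ennreal (norm (cond_exp M (F n) f x) powr p) \<partial>M) \<le> C"
  shows "(\<integral>\<^sup>+x. ennreal (norm (f x) powr p) \<partial>M) \<le> C"
proof -
  let ?f = "\<lambda>n. cond_exp M (F n) f"
  obtain r :: "nat \<Rightarrow> nat" where r: "AE x in M. (\<lambda>k. norm (f x - ?f (r k) x)) \<longlonglongrightarrow> 0"
    using tendsto_L1_AE_subseq[of M "\<lambda>n x. norm (f x - ?f n x)", OF cond_exp_tendsto_L1(1)[OF f]]
      cond_exp_tendsto_L1(2)[OF f] by auto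
  have [measurable]: "(\<lambda>x. norm (?f n x)) \<in> borel_measurable M" for n
    by (intro strongly_measurable_norm level_const_strongly_measurable[OF cond_exp_level_const[OF f]])
  have "(\<integral>\<^sup>+x. ennreal (norm (f x) powr p) \<partial>M) = (\<integral>\<^sup>+x. liminf (\<lambda>k. ennreal (norm (?f (r k) x) powr p)) \<partial>M)"
  proof (rule nn_integral_cong_AE, use r in eventually_elim)
    fix x assume "(\<lambda>k. norm (f x - ?f (r k) x)) \<longlonglongrightarrow> 0"
    then have "(\<lambda>k. f x - ?f (r k) x) \<longlonglongrightarrow> 0" by (simp only: tendsto_norm_zero_iff)
    from tendsto_diff[OF tendsto_const[of "f x"] this]
    have "(\<lambda>k. ?f (r k) x) \<longlonglongrightarrow> f x" by simp
    then have "(\<lambda>k. ennreal (norm (?f (r k) x) powr p)) \<longlonglongrightarrow> ennreal (norm (f x) powr p)"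
      using p by (intro tendsto_ennrealI tendsto_powr' tendsto_norm tendsto_const) auto
    then show "ennreal (norm (f x) powr p) = liminf (\<lambda>k. ennreal (norm (?f (r k) x) powr p))"
      by (intro lim_imp_Liminf[symmetric]) auto
  qed
  also have "\<dots> \<le> liminf (\<lambda>k. \<integral>\<^sup>+x. ennreal (norm (?f (r k) x) powr p) \<partial>M)"
    by (rule nn_integral_liminf) measurable
  also have "\<dots> \<le> liminf (\<lambda>k::nat. C)"
    by (intro Liminf_mono always_eventually allI bound)
  also have "\<dots> = C" by (simp add: Liminf_const)
  finally show ?thesis .
qed

lemma Lp_imp_L1:
  fixes f :: "'a \<Rightarrow> 'b::real_normed_vector"
  assumes p: "1 \<le> p" and f: "f \<in> Lp p M"
  shows "strongly_measurable M f" "(\<integral>\<^sup>+x. ennreal (norm (f x)) \<partial>M) < \<infinity>"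
proof -
  show sm: "strongly_measurable M f" using f by (simp add: Lp_def)
  note [measurable] = strongly_measurable_norm[OF sm]
  have fin: "(\<integral>\<^sup>+x. ennreal (norm (f x) powr p) \<partial>M) < \<infinity>"
    using f by (auto simp: Lp_def Lp_norm_def epowr_def less_top split: if_splits)
  have "(\<integral>\<^sup>+x. ennreal (norm (f x)) \<partial>M) \<le> (\<integral>\<^sup>+x. 1 + ennreal (norm (f x) powr p) \<partial>M)"
  proof (rule nn_integral_mono)
    fix x
    have "norm (f x) \<le> 1 + norm (f x) powr p"
    proof (cases "norm (f x) \<le> 1")
      case False
      then have "norm (f x) powr 1 \<le> norm (f x) powr p" using p by (intro powr_mono) auto
      then show ?thesis using False by simp
    qed (auto intro: add_increasing2)
    then have "ennreal (norm (f x)) \<le> ennreal (1 + norm (f x) powr p)" by (rule ennreal_leI)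
    then show "ennreal (norm (f x)) \<le> 1 + ennreal (norm (f x) powr p)" by (simp add: ennreal_plus)
  qed
  also have "\<dots> = 1 + (\<integral>\<^sup>+x. ennreal (norm (f x) powr p) \<partial>M)"
    by (subst nn_integral_add) (auto simp: emeasure_space_1)
  also have "\<dots> < \<infinity>" using fin by (simp add: less_top)
  finally show "(\<integral>\<^sup>+x. ennreal (norm (f x)) \<partial>M) < \<infinity>" .
qed

end

theorem theorem15:
  fixes M :: "'a measure" and F :: "nat \<Rightarrow> 'a measure"
    and \<A> :: "nat \<Rightarrow> 'a set set" and ch :: "nat \<Rightarrow> 'a set \<Rightarrow> 'a set list"
    and p :: real and f :: "'a \<Rightarrow> 'b::banach"
  assumes "finite_atomic_filtration M F \<A> ch"
    and "1 < p" and "p \<le> 2"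
    and "carleson M (E_coll \<A> ch) < \<infinity>"
    and "f \<in> Lp p M"
  shows "Lp_norm p M f \<le> T_const p (carleson M (E_coll \<A> ch)) *
           epowr (epowr (Lp_norm p M (cond_exp M (F 0) f)) p +
                  (\<Sum>n. epowr (Lp_norm p M (\<lambda>x. cond_exp M (F (Suc n)) f x -
                                               cond_exp M (F n) f x)) p)) (1 / p)"
proof -
  interpret finite_atomic_filtration M F \<A> ch by fact
  note p = assms(2,3)
  obtain K where K: "carleson M (E_coll \<A> ch) = ennreal K" "0 \<le> K"
    using assms(4) by (cases "carleson M (E_coll \<A> ch)") auto
  have f: "strongly_measurable M f" "(\<integral>\<^sup>+x. ennreal (norm (f x)) \<partial>M) < \<infinity>"
    using Lp_imp_L1[of p f] p assms(5) by auto
  define e where "e n = (\<integral>\<^sup>+x. ennreal (norm (cond_exp M (F (Suc n)) f x - cond_exp M (F n) f x) powr p) \<partial>M)" for n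
  define D where "D = (\<integral>\<^sup>+x. ennreal (norm (cond_exp M (F 0) f x) powr p) \<partial>M) + (\<Sum>n. e n)"
  let ?c = "6 * (4 * K + 1) powr (1 - 1 / p)"
  have c: "1 \<le> (4 * K + 1) powr (1 - 1 / p)"
    using K(2) p by (intro ge_one_powr_ge_zero) auto
  have "Lp_norm p M f \<le> ennreal ?c * epowr D (1 / p)"
  proof (cases D)
    case top
    have "ennreal ?c \<noteq> 0" using c by (auto simp: ennreal_eq_0_iff)
    then show ?thesis using top by (simp add: epowr_def ennreal_mult_top)
  next
    case (real r)
    let ?C = "6 * (4 * K + 1) powr (p - 1)"
    have "(\<integral>\<^sup>+x. ennreal (norm (f x) powr p) \<partial>M) \<le> ennreal ?C * D"
    proof (rule nn_integral_powr_le_of_cond_exp_bound[OF f])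
      show "(\<integral>\<^sup>+x. ennreal (norm (cond_exp M (F n) f x) powr p) \<partial>M) \<le> ennreal ?C * D" for n
        by (rule order_trans[OF nn_integral_cond_exp_powr_le[OF p K f]], unfold D_def e_def)
           (intro mult_left_mono add_left_mono sum_le_suminf; simp)
    qed (use p in simp)
    also have "\<dots> = ennreal (?C * r)" using real by (simp add: ennreal_mult)
    finally have "Lp_norm p M f \<le> epowr (ennreal (?C * r)) (1 / p)"
      unfolding Lp_norm_def using p by (intro epowr_mono) auto
    also have "\<dots> = ennreal ((?C * r) powr (1 / p))" using real by (intro epowr_ennreal) auto
    also have "\<dots> \<le> ennreal (?c * r powr (1 / p))"
    proof (rule ennreal_leI)
      have e: "(p - 1) * (1 / p) = 1 - 1 / p" using p by (simp add: field_simps)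
      have "(?C * r) powr (1 / p) = 6 powr (1 / p) * (4 * K + 1) powr (1 - 1 / p) * r powr (1 / p)"
        using real K(2) e by (simp add: powr_mult powr_powr)
      also have "\<dots> \<le> 6 powr 1 * (4 * K + 1) powr (1 - 1 / p) * r powr (1 / p)"
        using p by (intro mult_right_mono powr_mono) auto
      finally show "(?C * r) powr (1 / p) \<le> ?c * r powr (1 / p)" by simp
    qed
    also have "\<dots> = ennreal ?c * epowr D (1 / p)"
      using real by (simp add: epowr_ennreal ennreal_mult)
    finally show ?thesis .
  qed
  also have "\<dots> \<le> T_const p (carleson M (E_coll \<A> ch)) * epowr D (1 / p)"
    unfolding K(1) by (intro mult_right_mono T_const_ge p(1) K(2)) simp
  also have "D = epowr (Lp_norm p M (cond_exp M (F 0) f)) p +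
      (\<Sum>n. epowr (Lp_norm p M (\<lambda>x. cond_exp M (F (Suc n)) f x - cond_exp M (F n) f x)) p)"
    unfolding D_def e_def using p by (simp add: Lp_norm_epowr)
  finally show ?thesis .
qed

end
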